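(* Let $(\Omega,\mu)$ be a measure space, $\mathcal{H}$ a right quaternionic Hilbert space, $F:\Omega\to\mathcal{H}$ a Bessel mapping with pre-frame operator $T$ and frame operator $S$, and let $K\in\mathbb{B}(\mathcal{H})$. Then the following statements are equivalent. 1. $F$ is a continuous $K$-frame for $\mathcal{H}$. 2. $R(K)\subset R(T)$. 3. There exists a constant $c>0$ such that $KK^*c\leq S$. 4. There exists $X\in\mathbb{B}(\mathcal{H},L^2(\Omega,\mathbb{H}))$ such that $K=TX$.
   Context: $\mathbb{H}$ denotes the quaternions. A right quaternionic Hilbert space is a right $\mathbb{H}$-vector space $\mathcal{H}$ with an inner product $\langle\cdot,\cdot\rangle:\mathcal{H}\times\mathcal{H}\to\mathbb{H}$ such that $\langle u,v\rangle=\overline{\langle v,u\rangle}$, $\langle v,v\rangle>0$ for $v\neq0$, additive in the second variable with $\langle v,uq\rangle=\langle v,u\rangle q$ for $q\in\mathbb{H}$, and complete for $\|u\|=\sqrt{\langle u,u\rangle}$. $\mathbb{B}(\mathcal{H},\mathcal{K})$ is the set of bounded right $\mathbb{H}$-linear operators from $\mathcal{H}$ to $\mathcal{K}$, $\mathbb{B}(\mathcal{H})=\mathbb{B}(\mathcal{H},\mathcal{H})$, $L^*$ is the adjoint of $L$ and $R(L)$ its range. $L^2(\Omega,\mathbb{H})$ is the right quaternionic Hilbert space of measurable $g:\Omega\to\mathbb{H}$ with $\int_\Omega|g|^2d\mu<\infty$ (modulo a.e. equality), with $\langle g,h\rangle=\int_\Omega\overline{g(\omega)}h(\omega)\,d\mu(\omega)$.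 For self-adjoint $P,Q\in\mathbb{B}(\mathcal{H})$, $P\leq Q$ means $\langle Pu,u\rangle\leq\langle Qu,u\rangle$ for all $u$; for real $c$, $Pc$ is the operator $u\mapsto (Pu)c$. A weakly measurable $F:\Omega\to\mathcal{H}$ (i.e. $\omega\mapsto\langle F(\omega),u\rangle$ is measurable for each $u\in\mathcal{H}$) is a Bessel mapping for $\mathcal{H}$ if there is $0<B<\infty$ with $\int_\Omega|\langle F(\omega),u\rangle|^2d\mu(\omega)\leq B\|u\|^2$ for all $u\in\mathcal{H}$. For $K\in\mathbb{B}(\mathcal{H})$, it is a continuous $K$-frame for $\mathcal{H}$ if there are $0<A\leq B<\infty$ with $A\|K^*u\|^2\leq\int_\Omega|\langle F(\omega),u\rangle|^2d\mu(\omega)\leq B\|u\|^2$ for all $u\in\mathcal{H}$. For a Bessel mapping $F$: the transform operator $\theta\in\mathbb{B}(\mathcal{H},L^2(\Omega,\mathbb{H}))$ is $\theta(u)(\omega)=\langle F(\omega),u\rangle$; the pre-frame operator is $T=\theta^*:L^2(\Omega,\mathbb{H})\to\mathcal{H}$, $Tg=\int_\Omega F(\omega)g(\omega)\,d\mu(\omega)$ (weak sense); the frame operator is $S=T\theta$. An operator $X$ as in item 4 is called a $K$-dual mapping to $F$. *)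

theory Defs
  imports "HOL-Analysis.Analysis" "HOL-Algebra.Ring"
begin

section \<open>Quaternions\<close>

datatype quat = Quat (qRe: real) (qI: real) (qJ: real) (qK: real)

lemma quat_eq_iff:
  "p = q \<longleftrightarrow> qRe p = qRe q \<and> qI p = qI q \<and> qJ p = qJ q \<and> qK p = qK q"
  by (cases p; cases q) simp

instantiation quat :: real_inner
begin

definition zero_quat :: quat where "zero_quat = Quat 0 0 0 0"

definition plus_quat :: "quat \<Rightarrow> quat \<Rightarrow> quat" where
  "plus_quat p q = Quat (qRe p + qRe q) (qI p + qI q) (qJ p + qJ q) (qK p + qK q)"

definition uminus_quat :: "quat \<Rightarrow> quat" where
  "uminus_quat p = Quat (- qRe p) (- qI p) (- qJ p) (- qK p)"

definition minus_quat :: "quat \<Rightarrow> quat \<Rightarrow> quat" where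
  "minus_quat p q = Quat (qRe p - qRe q) (qI p - qI q) (qJ p - qJ q) (qK p - qK q)"

definition scaleR_quat :: "real \<Rightarrow> quat \<Rightarrow> quat" where
  "scaleR_quat r p = Quat (r * qRe p) (r * qI p) (r * qJ p) (r * qK p)"

definition inner_quat :: "quat \<Rightarrow> quat \<Rightarrow> real" where
  "inner_quat p q = qRe p * qRe q + qI p * qI q + qJ p * qJ q + qK p * qK q"

definition norm_quat :: "quat \<Rightarrow> real" where
  "norm_quat p = sqrt (inner p p)"

definition sgn_quat :: "quat \<Rightarrow> quat" where
  "sgn_quat p = scaleR (inverse (norm p)) p"

definition dist_quat :: "quat \<Rightarrow> quat \<Rightarrow> real" where
  "dist_quat p q = norm (p - q)"

definition uniformity_quat :: "(quat \<times> quat) filter" where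
  "uniformity_quat = (INF e\<in>{0<..}. principal {(x, y). dist x y < e})"

definition open_quat :: "quat set \<Rightarrow> bool" where
  "open_quat U \<longleftrightarrow> (\<forall>x\<in>U. eventually (\<lambda>(x', y). x' = x \<longrightarrow> y \<in> U) uniformity)"

lemmas quat_linear_defs = zero_quat_def plus_quat_def uminus_quat_def minus_quat_def
  scaleR_quat_def inner_quat_def

instance
proof
  fix p q r :: quat
  have eq0: "a * a + b * b + c * c + d * d = 0 \<longleftrightarrow> a = 0 \<and> b = 0 \<and> c = 0 \<and> d = 0"
    for a b c d :: real
    by (simp add: add_nonneg_eq_0_iff)
  show "0 \<le> inner p p"
    by (simp add: inner_quat_def)
  show "inner p p = 0 \<longleftrightarrow> p = 0"
    unfolding inner_quat_def eq0 by (simp add: quat_eq_iff zero_quat_def)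
qed (simp_all add: quat_eq_iff quat_linear_defs norm_quat_def sgn_quat_def dist_quat_def
      uniformity_quat_def open_quat_def algebra_simps)

end

lemma quat_linear_simps [simp]:
  "qRe 0 = 0" "qI 0 = 0" "qJ 0 = 0" "qK 0 = 0"
  "qRe (p + q) = qRe p + qRe q" "qI (p + q) = qI p + qI q"
  "qJ (p + q) = qJ p + qJ q" "qK (p + q) = qK p + qK q"
  "qRe (- p) = - qRe p" "qI (- p) = - qI p" "qJ (- p) = - qJ p" "qK (- p) = - qK p"
  "qRe (p - q) = qRe p - qRe q" "qI (p - q) = qI p - qI q"
  "qJ (p - q) = qJ p - qJ q" "qK (p - q) = qK p - qK q"
  "qRe (a *\<^sub>R p) = a * qRe p" "qI (a *\<^sub>R p) = a * qI p"
  "qJ (a *\<^sub>R p) = a * qJ p" "qK (a *\<^sub>R p) = a * qK p"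
  by (simp_all add: quat_linear_defs)

lemma norm_quat_eq: "norm p = sqrt ((qRe p)\<^sup>2 + (qI p)\<^sup>2 + (qJ p)\<^sup>2 + (qK p)\<^sup>2)"
  by (simp add: norm_quat_def inner_quat_def power2_eq_square)

lemma four_squares:
  fixes a b c d e f g h :: real
  shows "(a * e - b * f - c * g - d * h)\<^sup>2 + (a * f + b * e + c * h - d * g)\<^sup>2
       + (a * g - b * h + c * e + d * f)\<^sup>2 + (a * h + b * g - c * f + d * e)\<^sup>2
       = (a\<^sup>2 + b\<^sup>2 + c\<^sup>2 + d\<^sup>2) * (e\<^sup>2 + f\<^sup>2 + g\<^sup>2 + h\<^sup>2)"
  by (simp add: power2_eq_square algebra_simps)

instantiation quat :: real_normed_div_algebra
begin

definition one_quat :: quat where "one_quat = Quat 1 0 0 0"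

definition times_quat :: "quat \<Rightarrow> quat \<Rightarrow> quat" where
  "times_quat p q = Quat
     (qRe p * qRe q - qI p * qI q - qJ p * qJ q - qK p * qK q)
     (qRe p * qI q + qI p * qRe q + qJ p * qK q - qK p * qJ q)
     (qRe p * qJ q - qI p * qK q + qJ p * qRe q + qK p * qI q)
     (qRe p * qK q + qI p * qJ q - qJ p * qI q + qK p * qRe q)"

definition inverse_quat :: "quat \<Rightarrow> quat" where
  "inverse_quat p = Quat (qRe p / (norm p)\<^sup>2) (- qI p / (norm p)\<^sup>2)
     (- qJ p / (norm p)\<^sup>2) (- qK p / (norm p)\<^sup>2)"

definition divide_quat :: "quat \<Rightarrow> quat \<Rightarrow> quat" where
  "divide_quat p q = p * inverse q"

instance
proof
  fix p q r :: quat and a :: real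
  have nz: "(norm p)\<^sup>2 \<noteq> 0" if "p \<noteq> 0"
    using that by simp
  have nsq: "(norm p)\<^sup>2 = qRe p * qRe p + qI p * qI p + qJ p * qJ p + qK p * qK p" for p :: quat
    by (simp add: norm_quat_eq power2_eq_square)
  show "inverse p * p = 1" if "p \<noteq> 0"
  proof -
    have "qRe p * qRe p / (norm p)\<^sup>2 + qI p * qI p / (norm p)\<^sup>2
        + qJ p * qJ p / (norm p)\<^sup>2 + qK p * qK p / (norm p)\<^sup>2 = 1"
      using nz[OF that] by (simp add: nsq flip: add_divide_distrib)
    then show ?thesis
      by (simp add: quat_eq_iff times_quat_def inverse_quat_def one_quat_def algebra_simps)
  qed
  show "p * inverse p = 1" if "p \<noteq> 0"
  proof -
    have "qRe p * qRe p / (norm p)\<^sup>2 + qI p * qI p / (norm p)\<^sup>2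
        + qJ p * qJ p / (norm p)\<^sup>2 + qK p * qK p / (norm p)\<^sup>2 = 1"
      using nz[OF that] by (simp add: nsq flip: add_divide_distrib)
    then show ?thesis
      by (simp add: quat_eq_iff times_quat_def inverse_quat_def one_quat_def algebra_simps)
  qed
  show "inverse (0 :: quat) = 0"
    by (simp add: quat_eq_iff inverse_quat_def)
  have "(norm (p * q))\<^sup>2 = (norm p * norm q)\<^sup>2"
    unfolding power_mult_distrib nsq times_quat_def quat.sel
    using four_squares[of "qRe p" "qRe q" "qI p" "qI q" "qJ p" "qJ q" "qK p" "qK q"]
    by (simp only: power2_eq_square)
  then show "norm (p * q) = norm p * norm q"
    by simp
  show "p * q * r = p * (q * r)"
    unfolding quat_eq_iff times_quat_def quat.sel by (intro conjI; simp add: algebra_simps)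
  show "(p + q) * r = p * r + q * r"
    by (simp add: quat_eq_iff times_quat_def algebra_simps)
  show "p * (q + r) = p * q + p * r"
    by (simp add: quat_eq_iff times_quat_def algebra_simps)
  show "(a *\<^sub>R p) * q = a *\<^sub>R (p * q)"
    by (simp add: quat_eq_iff times_quat_def algebra_simps)
  show "p * (a *\<^sub>R q) = a *\<^sub>R (p * q)"
    by (simp add: quat_eq_iff times_quat_def algebra_simps)
  show "1 * p = p" "p * 1 = p" "(0 :: quat) \<noteq> 1"
    by (simp_all add: quat_eq_iff times_quat_def one_quat_def)
qed (rule divide_quat_def)

end

instantiation quat :: euclidean_space
begin

definition Basis_quat :: "quat set" where
  "Basis_quat = {Quat 1 0 0 0, Quat 0 1 0 0, Quat 0 0 1 0, Quat 0 0 0 1}"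

instance
proof
  fix u v x :: quat
  show "inner u v = (if u = v then 1 else 0)" if "u \<in> Basis" "v \<in> Basis"
    using that unfolding Basis_quat_def insert_iff empty_iff inner_quat_def
    by (elim disjE FalseE) simp_all
  show "(\<forall>u\<in>Basis. inner x u = 0) \<longleftrightarrow> x = 0"
    by (simp add: Basis_quat_def inner_quat_def quat_eq_iff[of x 0])
qed (simp_all add: Basis_quat_def)

end

text \<open>
  The order extends that of the reals, with only quaternions of equal imaginary part comparable;
  thus \<open>0 \<le> q\<close> means that \<open>q\<close> is real and nonnegative.
\<close>

instantiation quat :: order
begin

definition less_eq_quat :: "quat \<Rightarrow> quat \<Rightarrow> bool" where
  "p \<le> q \<longleftrightarrow> qRe p \<le> qRe q \<and> qI p = qI q \<and> qJ p = qJ q \<and> qK p = qK q"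

definition less_quat :: "quat \<Rightarrow> quat \<Rightarrow> bool" where
  "p < q \<longleftrightarrow> qRe p < qRe q \<and> qI p = qI q \<and> qJ p = qJ q \<and> qK p = qK q"

instance
  by standard (auto simp: less_eq_quat_def less_quat_def quat_eq_iff)

end

definition qcnj :: "quat \<Rightarrow> quat" where
  "qcnj p = Quat (qRe p) (- qI p) (- qJ p) (- qK p)"

section \<open>Right quaternionic Hilbert spaces\<close>

text \<open>
  The record inherits the fields \<open>mult\<close> and \<open>one\<close>, which carry no meaning here,
  just as in the records of the algebra library's \<open>module\<close> locale; they are left undefined in \<open>L2\<close> below.
\<close>

record 'a quat_space = "'a ring" +
  qscale :: "'a \<Rightarrow> quat \<Rightarrow> 'a"
  qinner :: "'a \<Rightarrow> 'a \<Rightarrow> quat"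

definition qnorm :: "'a quat_space \<Rightarrow> 'a \<Rightarrow> real" where
  "qnorm H u = sqrt (qRe (qinner H u u))"

locale right_quat_vector_space = abelian_group H
  for H :: "'a quat_space" (structure) +
  assumes scale_closed: "u \<in> carrier H \<Longrightarrow> qscale H u q \<in> carrier H"
    and scale_add_left: "\<lbrakk>u \<in> carrier H; v \<in> carrier H\<rbrakk> \<Longrightarrow>
      qscale H (u \<oplus> v) q = qscale H u q \<oplus> qscale H v q"
    and scale_add_right: "u \<in> carrier H \<Longrightarrow> qscale H u (p + q) = qscale H u p \<oplus> qscale H u q"
    and scale_mult: "u \<in> carrier H \<Longrightarrow> qscale H u (p * q) = qscale H (qscale H u p) q"
    and scale_one: "u \<in> carrier H \<Longrightarrow> qscale H u 1 = u"

locale right_quat_hilbert_space = right_quat_vector_space +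
  assumes inner_cnj: "\<lbrakk>u \<in> carrier H; v \<in> carrier H\<rbrakk> \<Longrightarrow> qinner H u v = qcnj (qinner H v u)"
    and inner_pos: "\<lbrakk>v \<in> carrier H; v \<noteq> \<zero>\<rbrakk> \<Longrightarrow> 0 < qinner H v v"
    and inner_add: "\<lbrakk>v \<in> carrier H; u \<in> carrier H; w \<in> carrier H\<rbrakk> \<Longrightarrow>
      qinner H v (u \<oplus> w) = qinner H v u + qinner H v w"
    and inner_scale: "\<lbrakk>v \<in> carrier H; u \<in> carrier H\<rbrakk> \<Longrightarrow>
      qinner H v (qscale H u q) = qinner H v u * q"
    and complete: "\<lbrakk>\<And>n::nat. s n \<in> carrier H;
        \<And>e. 0 < e \<Longrightarrow> \<exists>N. \<forall>m\<ge>N. \<forall>n\<ge>N. qnorm H (s m \<ominus> s n) < e\<rbrakk> \<Longrightarrow>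
      \<exists>l\<in>carrier H. (\<lambda>n. qnorm H (s n \<ominus> l)) \<longlonglongrightarrow> 0"

section \<open>Bounded operators\<close>

text \<open>
  Operators are extensional functions on the carrier, so that equality of operators is
  equality of HOL functions.
\<close>

definition bounded_ops :: "'a quat_space \<Rightarrow> 'b quat_space \<Rightarrow> ('a \<Rightarrow> 'b) set" where
  "bounded_ops H K = {L \<in> carrier H \<rightarrow>\<^sub>E carrier K.
     (\<forall>u\<in>carrier H. \<forall>v\<in>carrier H. L (u \<oplus>\<^bsub>H\<^esub> v) = L u \<oplus>\<^bsub>K\<^esub> L v) \<and>
     (\<forall>u\<in>carrier H. \<forall>q. L (qscale H u q) = qscale K (L u) q) \<and>
     (\<exists>C. \<forall>u\<in>carrier H. qnorm K (L u) \<le> C * qnorm H u)}"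

definition op_adjoint :: "'a quat_space \<Rightarrow> 'b quat_space \<Rightarrow> ('a \<Rightarrow> 'b) \<Rightarrow> ('b \<Rightarrow> 'a)" where
  "op_adjoint H K L = (THE A. A \<in> bounded_ops K H \<and>
     (\<forall>u\<in>carrier H. \<forall>v\<in>carrier K. qinner K (L u) v = qinner H u (A v)))"

definition op_comp :: "'a quat_space \<Rightarrow> ('b \<Rightarrow> 'c) \<Rightarrow> ('a \<Rightarrow> 'b) \<Rightarrow> ('a \<Rightarrow> 'c)" where
  "op_comp H P Q = compose (carrier H) P Q"

definition op_scale :: "'a quat_space \<Rightarrow> ('a \<Rightarrow> 'a) \<Rightarrow> real \<Rightarrow> ('a \<Rightarrow> 'a)" where
  "op_scale H P c = (\<lambda>u\<in>carrier H. qscale H (P u) (of_real c))"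

definition op_le :: "'a quat_space \<Rightarrow> ('a \<Rightarrow> 'a) \<Rightarrow> ('a \<Rightarrow> 'a) \<Rightarrow> bool" where
  "op_le H P Q \<longleftrightarrow> (\<forall>u\<in>carrier H. qinner H (P u) u \<le> qinner H (Q u) u)"

section \<open>The space of square-integrable quaternion-valued functions\<close>

definition L2_fun :: "'w measure \<Rightarrow> ('w \<Rightarrow> quat) set" where
  "L2_fun M = {g \<in> borel_measurable M. integrable M (\<lambda>w. (norm (g w))\<^sup>2)}"

definition L2_rel :: "'w measure \<Rightarrow> (('w \<Rightarrow> quat) \<times> ('w \<Rightarrow> quat)) set" where
  "L2_rel M = {(g, h). g \<in> L2_fun M \<and> h \<in> L2_fun M \<and> (AE w in M. g w = h w)}"

definition L2_class :: "'w measure \<Rightarrow> ('w \<Rightarrow> quat) \<Rightarrow> ('w \<Rightarrow> quat) set" where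
  "L2_class M g = L2_rel M `` {g}"

definition L2_rep :: "('w \<Rightarrow> quat) set \<Rightarrow> ('w \<Rightarrow> quat)" where
  "L2_rep G = (SOME g. g \<in> G)"

definition L2 :: "'w measure \<Rightarrow> ('w \<Rightarrow> quat) set quat_space" where
  "L2 M = \<lparr>carrier = L2_fun M // L2_rel M,
     mult = (\<lambda>_ _. undefined), one = undefined,
     zero = L2_class M (\<lambda>_. 0),
     add = (\<lambda>G H. L2_class M (\<lambda>w. L2_rep G w + L2_rep H w)),
     qscale = (\<lambda>G q. L2_class M (\<lambda>w. L2_rep G w * q)),
     qinner = (\<lambda>G H. LINT w|M. qcnj (L2_rep G w) * L2_rep H w)\<rparr>"

section \<open>Bessel mappings and continuous frames\<close>

definition weakly_measurable :: "'w measure \<Rightarrow> 'a quat_space \<Rightarrow> ('w \<Rightarrow> 'a) \<Rightarrow> bool" where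
  "weakly_measurable M H F \<longleftrightarrow> F \<in> space M \<rightarrow> carrier H \<and>
     (\<forall>u\<in>carrier H. (\<lambda>w. qinner H (F w) u) \<in> borel_measurable M)"

definition bessel_mapping :: "'w measure \<Rightarrow> 'a quat_space \<Rightarrow> ('w \<Rightarrow> 'a) \<Rightarrow> bool" where
  "bessel_mapping M H F \<longleftrightarrow> weakly_measurable M H F \<and>
     (\<exists>B::real. 0 < B \<and> (\<forall>u\<in>carrier H.
        (\<integral>\<^sup>+ w. ennreal ((norm (qinner H (F w) u))\<^sup>2) \<partial>M) \<le> ennreal (B * (qnorm H u)\<^sup>2)))"

definition continuous_K_frame ::
    "'w measure \<Rightarrow> 'a quat_space \<Rightarrow> ('a \<Rightarrow> 'a) \<Rightarrow> ('w \<Rightarrow> 'a) \<Rightarrow> bool" where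
  "continuous_K_frame M H K F \<longleftrightarrow> weakly_measurable M H F \<and>
     (\<exists>A B::real. 0 < A \<and> A \<le> B \<and> (\<forall>u\<in>carrier H.
        ennreal (A * (qnorm H (op_adjoint H H K u))\<^sup>2)
          \<le> (\<integral>\<^sup>+ w. ennreal ((norm (qinner H (F w) u))\<^sup>2) \<partial>M) \<and>
        (\<integral>\<^sup>+ w. ennreal ((norm (qinner H (F w) u))\<^sup>2) \<partial>M) \<le> ennreal (B * (qnorm H u)\<^sup>2)))"

definition transform_op ::
    "'w measure \<Rightarrow> 'a quat_space \<Rightarrow> ('w \<Rightarrow> 'a) \<Rightarrow> ('a \<Rightarrow> ('w \<Rightarrow> quat) set)" where
  "transform_op M H F = (\<lambda>u\<in>carrier H. L2_class M (\<lambda>w. qinner H (F w) u))"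

definition pre_frame_op ::
    "'w measure \<Rightarrow> 'a quat_space \<Rightarrow> ('w \<Rightarrow> 'a) \<Rightarrow> (('w \<Rightarrow> quat) set \<Rightarrow> 'a)" where
  "pre_frame_op M H F = op_adjoint H (L2 M) (transform_op M H F)"

definition frame_op :: "'w measure \<Rightarrow> 'a quat_space \<Rightarrow> ('w \<Rightarrow> 'a) \<Rightarrow> ('a \<Rightarrow> 'a)" where
  "frame_op M H F = op_comp H (pre_frame_op M H F) (transform_op M H F)"

end

theory Submission
  imports Defs
begin

text \<open>
  Write \<open>\<theta>\<close> for the transform operator, so that \<open>T = \<theta>*\<close>. The energy integral of the frame inequality at
  \<open>u\<close> is \<open>\<parallel>\<theta> u\<parallel>\<^sup>2\<close>, and so is \<open>\<langle>S u, u\<rangle> = \<langle>T \<theta> u, u\<rangle>\<close>; likewise \<open>\<langle>K K* u, u\<rangle> = \<parallel>K* u\<parallel>\<^sup>2\<close>. Hence the lower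
  frame bound and the operator inequality are both the majorization \<open>c \<parallel>K* u\<parallel>\<^sup>2 \<le> \<parallel>\<theta> u\<parallel>\<^sup>2\<close>, and
  what remains is Douglas' factorization theorem: for bounded \<open>K : E \<rightarrow> H\<close> and \<open>L : H \<rightarrow> G\<close> between
  Hilbert spaces, range inclusion \<open>R(K) \<subseteq> R(L*)\<close>, majorization of \<open>K*\<close> by \<open>L\<close>, and
  solvability of \<open>K = L* X\<close> are equivalent.

  If the ranges are included, write \<open>K x = L* g\<close>; then \<open>\<langle>K* u, x\<rangle> = \<langle>L u, g\<rangle>\<close> shows that the vectors
  \<open>K* u\<close> with \<open>\<parallel>L u\<parallel> \<le> 1\<close> are weakly bounded. The uniform boundedness principle
  (\<open>weakly_bounded_imp_bounded\<close>) makes them bounded in norm, and homogeneity turns this into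
  majorization. Conversely, majorization says that for each \<open>v\<close> the functional \<open>L u \<mapsto> \<langle>K v, u\<rangle>\<close> is well
  defined and bounded on the range of \<open>L\<close>. Its Riesz representative in the closure of that range is \<open>X v\<close>.

  The Riesz theorem is proved directly in the form needed here
  (\<open>functional_on_range_representable\<close>): for a functional \<open>\<psi>\<close> on \<open>H\<close> with \<open>|\<psi> u| \<le> C \<parallel>L u\<parallel>\<close>, the
  values \<open>L u\<close> along a sequence minimizing \<open>\<parallel>L u\<parallel>\<^sup>2 - 2 Re (\<psi> u)\<close> converge to the representative. The identity for \<open>L\<close>
  gives the usual Riesz theorem and thereby adjoints. Both steps use completeness: the boundedness
  principle that of \<open>E\<close>, the representation that of \<open>G\<close>. Since the theorem has \<open>G = L\<^sup>2\<close>, it also rests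
  on the Riesz-Fischer theorem for quaternion-valued functions.
\<close>

section \<open>Quaternion conjugation\<close>

lemma qcnj_simps [simp]:
  "qRe (qcnj p) = qRe p" "qI (qcnj p) = - qI p" "qJ (qcnj p) = - qJ p" "qK (qcnj p) = - qK p"
  by (simp_all add: qcnj_def)

lemma qcnj_add [simp]: "qcnj (p + q) = qcnj p + qcnj q"
  by (simp add: quat_eq_iff)

lemma qcnj_mult [simp]: "qcnj (p * q) = qcnj q * qcnj p"
  by (simp add: quat_eq_iff times_quat_def algebra_simps)

lemma qcnj_qcnj [simp]: "qcnj (qcnj p) = p"
  by (simp add: quat_eq_iff)

lemma norm_qcnj [simp]: "norm (qcnj p) = norm p"
  by (simp add: norm_quat_eq)

lemma quat_of_real_sel [simp]:
  "qRe (of_real r) = r" "qI (of_real r) = 0" "qJ (of_real r) = 0" "qK (of_real r) = 0"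
  by (simp_all add: of_real_def one_quat_def)

lemma qcnj_of_real [simp]: "qcnj (of_real r) = of_real r"
  by (simp add: quat_eq_iff)

lemma qcnj_zero [simp]: "qcnj 0 = 0"
  by (simp add: quat_eq_iff)

lemma mult_qcnj_self: "p * qcnj p = of_real ((norm p)\<^sup>2)"
  by (simp add: quat_eq_iff times_quat_def norm_quat_eq power2_eq_square
      del: of_real_add of_real_mult of_real_power)

lemma qcnj_mult_self: "qcnj p * p = of_real ((norm p)\<^sup>2)"
  using mult_qcnj_self[of "qcnj p"] by simp

lemma quat_of_real_commute: "of_real r * (p :: quat) = p * of_real r"
  by (simp add: quat_eq_iff times_quat_def)

lemma qRe_mult_of_real [simp]: "qRe (p * of_real r) = qRe p * r"
  by (simp add: times_quat_def)

lemma qRe_le_norm: "qRe p \<le> norm p"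
  by (rule order_trans[OF abs_ge_self], unfold norm_quat_eq, rule real_le_rsqrt) simp

text \<open>
  An identity of real parts that survives right multiplication by every quaternion determines a
  quaternion. Variational arguments, which only see real parts, thus suffice for right-linear maps.
\<close>

lemma quat_eqI_qRe:
  assumes "\<And>r. qRe (p * r) = qRe (q * r)"
  shows "p = q"
proof -
  have "qRe ((p - q) * qcnj (p - q)) = 0"
    using assms[of "qcnj (p - q)"] by (simp only: left_diff_distrib quat_linear_simps)
  then show ?thesis by (simp add: mult_qcnj_self del: of_real_power)
qed

section \<open>Geometry of right quaternionic Hilbert spaces\<close>

context right_quat_hilbert_space
begin

lemma inner_zero_right [simp]: "v \<in> carrier H \<Longrightarrow> qinner H v \<zero> = 0"
  using inner_add[of v "\<zero>" "\<zero>"] by simp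

lemma inner_minus: "\<lbrakk>v \<in> carrier H; u \<in> carrier H\<rbrakk> \<Longrightarrow> qinner H v (\<ominus> u) = - qinner H v u"
  using inner_add[of v u "\<ominus> u"] by (simp add: r_neg eq_neg_iff_add_eq_0 add.commute)

lemma inner_diff: "\<lbrakk>v \<in> carrier H; u \<in> carrier H; w \<in> carrier H\<rbrakk> \<Longrightarrow>
    qinner H v (u \<ominus> w) = qinner H v u - qinner H v w"
  by (simp add: minus_eq inner_add inner_minus)

lemma inner_zero_left [simp]: "v \<in> carrier H \<Longrightarrow> qinner H \<zero> v = 0"
  using inner_cnj[of "\<zero>" v] by simp

lemma inner_add_left: "\<lbrakk>v \<in> carrier H; u \<in> carrier H; w \<in> carrier H\<rbrakk> \<Longrightarrow>
    qinner H (u \<oplus> w) v = qinner H u v + qinner H w v"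
  using inner_cnj[of "u \<oplus> w" v] inner_cnj[of u v] inner_cnj[of w v] by (simp add: inner_add)

lemma inner_diff_left: "\<lbrakk>v \<in> carrier H; u \<in> carrier H; w \<in> carrier H\<rbrakk> \<Longrightarrow>
    qinner H (u \<ominus> w) v = qinner H u v - qinner H w v"
  using inner_cnj[of "u \<ominus> w" v] inner_cnj[of u v] inner_cnj[of w v]
  by (simp add: inner_diff) (simp add: quat_eq_iff)

lemma inner_scale_left: "\<lbrakk>v \<in> carrier H; u \<in> carrier H\<rbrakk> \<Longrightarrow>
    qinner H (qscale H u q) v = qcnj q * qinner H u v"
  using inner_cnj[of "qscale H u q" v] inner_cnj[of u v] by (simp add: inner_scale scale_closed)

lemmas inner_linear = inner_add inner_diff inner_scale inner_add_left inner_diff_left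
  inner_scale_left inner_minus scale_closed

lemma inner_self_nonneg: "v \<in> carrier H \<Longrightarrow> 0 \<le> qinner H v v"
  by (cases "v = \<zero>") (auto dest: inner_pos)

lemma qnorm_nonneg [simp]: "v \<in> carrier H \<Longrightarrow> 0 \<le> qnorm H v"
  using inner_self_nonneg[of v] by (simp add: qnorm_def less_eq_quat_def)

lemma qnorm_sq: "v \<in> carrier H \<Longrightarrow> (qnorm H v)\<^sup>2 = qRe (qinner H v v)"
  using inner_self_nonneg[of v] by (simp add: qnorm_def less_eq_quat_def)

lemma inner_self: "v \<in> carrier H \<Longrightarrow> qinner H v v = of_real ((qnorm H v)\<^sup>2)"
  using inner_self_nonneg[of v] by (simp add: qnorm_sq quat_eq_iff less_eq_quat_def)

lemma qnorm_zero [simp]: "qnorm H \<zero> = 0"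
  by (simp add: qnorm_def)

lemma qnorm_eq_0_iff: "v \<in> carrier H \<Longrightarrow> qnorm H v = 0 \<longleftrightarrow> v = \<zero>"
  using inner_pos[of v] by (metis inner_self of_real_0 order_less_irrefl zero_power2 qnorm_zero)

lemma eq_if_diff_zero: "\<lbrakk>u \<in> carrier H; v \<in> carrier H; u \<ominus> v = \<zero>\<rbrakk> \<Longrightarrow> u = v"
  using minus_equality[of u "\<ominus> v"] by (simp add: minus_eq)

text \<open>
  Identities between vectors reduce to quaternion arithmetic by testing against all \<open>z\<close>; this
  replaces calculation in the abelian group and gives linearity of adjoints for free.
\<close>

lemma vector_eqI:
  assumes "u \<in> carrier H" "v \<in> carrier H"
    and "\<And>z. z \<in> carrier H \<Longrightarrow> qinner H z u = qinner H z v"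
  shows "u = v"
proof -
  have "qinner H (u \<ominus> v) (u \<ominus> v) = 0"
    using assms(1,2) assms(3)[of "u \<ominus> v"] by (simp add: inner_diff)
  then have "u \<ominus> v = \<zero>"
    using assms(1,2) inner_pos[of "u \<ominus> v"] by auto
  then show ?thesis using assms(1,2) by (rule eq_if_diff_zero[rotated 2])
qed

lemma qnorm_add_sq:
  assumes "u \<in> carrier H" "v \<in> carrier H"
  shows "(qnorm H (u \<oplus> v))\<^sup>2 = (qnorm H u)\<^sup>2 + 2 * qRe (qinner H u v) + (qnorm H v)\<^sup>2"
  using assms inner_cnj[of v u] by (simp add: qnorm_sq inner_linear)

lemma qnorm_scale:
  assumes "u \<in> carrier H"
  shows "qnorm H (qscale H u q) = qnorm H u * norm q"
proof -
  have "qinner H (qscale H u q) (qscale H u q) = qcnj q * (of_real ((qnorm H u)\<^sup>2) * q)"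
    using assms by (simp add: inner_linear inner_self[OF assms] mult.assoc del: of_real_power)
  also have "\<dots> = of_real ((norm q)\<^sup>2 * (qnorm H u)\<^sup>2)"
    by (simp only: quat_of_real_commute[of _ q] qcnj_mult_self of_real_mult mult.assoc[symmetric])
  finally have "qinner H (qscale H u q) (qscale H u q) = of_real ((norm q)\<^sup>2 * (qnorm H u)\<^sup>2)" .
  then show ?thesis
    unfolding qnorm_def[of H "qscale H u q"] using assms
    by (simp add: real_sqrt_mult del: of_real_mult of_real_power)
qed

lemma qRe_inner_le:
  assumes u: "u \<in> carrier H" and v: "v \<in> carrier H"
  shows "qRe (qinner H u v) \<le> qnorm H u * qnorm H v"
proof (cases "qnorm H u = 0 \<or> qnorm H v = 0")
  case True
  then show ?thesis using assms by (auto simp: qnorm_eq_0_iff)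
next
  case False
  define a b where "a = qnorm H u" and "b = qnorm H v"
  have pos: "a > 0" "b > 0"
    using False assms by (auto simp: a_def b_def order_less_le)
  have "0 \<le> (qnorm H (qscale H u (of_real b) \<oplus> qscale H v (of_real (- a))))\<^sup>2" by simp
  also have "\<dots> = 2 * (a * b) * (a * b - qRe (qinner H u v))"
    using assms
    by (simp add: qnorm_add_sq scale_closed inner_scale inner_scale_left qnorm_scale
        quat_of_real_commute[of b] mult.assoc a_def[symmetric] b_def[symmetric] del: of_real_minus)
      (simp add: power2_eq_square algebra_simps flip: of_real_mult)
  finally show ?thesis using pos mult_pos_pos[OF pos]
    by (auto simp add: zero_le_mult_iff a_def[symmetric] b_def[symmetric])
qed

text \<open>
  Replacing \<open>v\<close> by \<open>v q\<close>, with \<open>q\<close> the conjugate of \<open>\<langle>u, v\<rangle>\<close>, makes the inner product real, so the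
  bound on real parts is enough.
\<close>

lemma Cauchy_Schwarz:
  assumes u: "u \<in> carrier H" and v: "v \<in> carrier H"
  shows "norm (qinner H u v) \<le> qnorm H u * qnorm H v"
proof -
  define q where "q = qinner H u v"
  have "norm q * norm q \<le> (qnorm H u * qnorm H v) * norm q"
    using qRe_inner_le[OF u scale_closed[OF v], of "qcnj q"] assms
    by (simp add: inner_scale qnorm_scale q_def[symmetric] mult_qcnj_self power2_eq_square mult.assoc
        del: of_real_mult)
  then show ?thesis using assms
    by (cases "norm q = 0") (auto simp: q_def[symmetric])
qed

lemma qnorm_triangle:
  assumes "u \<in> carrier H" "v \<in> carrier H"
  shows "qnorm H (u \<oplus> v) \<le> qnorm H u + qnorm H v"
proof (rule power2_le_imp_le)
  show "(qnorm H (u \<oplus> v))\<^sup>2 \<le> (qnorm H u + qnorm H v)\<^sup>2"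
    using assms qRe_inner_le[OF assms] by (simp add: qnorm_add_sq power2_sum)
qed (use assms in simp)

lemma qnorm_diff_triangle:
  assumes "u \<in> carrier H" "v \<in> carrier H" "w \<in> carrier H"
  shows "qnorm H (u \<ominus> w) \<le> qnorm H (u \<ominus> v) + qnorm H (v \<ominus> w)"
proof -
  have "u \<ominus> w = (u \<ominus> v) \<oplus> (v \<ominus> w)"
    by (rule vector_eqI) (use assms in \<open>simp_all add: inner_linear\<close>)
  then show ?thesis using assms by (simp add: qnorm_triangle)
qed

lemma qnorm_diff_commute:
  assumes "u \<in> carrier H" "v \<in> carrier H"
  shows "qnorm H (u \<ominus> v) = qnorm H (v \<ominus> u)"
  using assms by (simp add: qnorm_def inner_linear)

lemma qnorm_diff_le: 
  assumes "u \<in> carrier H" "v \<in> carrier H"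
  shows "qnorm H u - qnorm H v \<le> qnorm H (u \<ominus> v)"
proof -
  have "u = (u \<ominus> v) \<oplus> v"
    by (rule vector_eqI) (use assms in \<open>simp_all add: inner_linear\<close>)
  then show ?thesis using assms qnorm_triangle[of "u \<ominus> v" v] by simp
qed

lemma inner_tendsto:
  assumes s: "\<And>n. s n \<in> carrier H" and l: "l \<in> carrier H" and z: "z \<in> carrier H"
    and lim: "(\<lambda>n. qnorm H (s n \<ominus> l)) \<longlonglongrightarrow> 0"
  shows "(\<lambda>n. qinner H z (s n)) \<longlonglongrightarrow> qinner H z l"
proof (rule LIM_zero_cancel, rule tendsto_norm_zero_cancel, rule tendsto_sandwich[OF _ _ tendsto_const])
  show "(\<lambda>n. qnorm H z * qnorm H (s n \<ominus> l)) \<longlonglongrightarrow> 0"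
    using tendsto_mult_right_zero[OF lim, of "qnorm H z"] .
  show "\<forall>\<^sub>F n in sequentially. norm (qinner H z (s n) - qinner H z l) \<le> qnorm H z * qnorm H (s n \<ominus> l)"
    using Cauchy_Schwarz[OF z, of "s _ \<ominus> l"] s l z by (simp add: inner_diff)
qed simp

lemma qnorm_tendsto:
  assumes s: "\<And>n. s n \<in> carrier H" and l: "l \<in> carrier H"
    and lim: "(\<lambda>n. qnorm H (s n \<ominus> l)) \<longlonglongrightarrow> 0"
  shows "(\<lambda>n. qnorm H (s n)) \<longlonglongrightarrow> qnorm H l"
proof (rule LIM_zero_cancel, rule tendsto_rabs_zero_cancel, rule tendsto_sandwich[OF _ _ tendsto_const lim])
  show "\<forall>\<^sub>F n in sequentially. \<bar>qnorm H (s n) - qnorm H l\<bar> \<le> qnorm H (s n \<ominus> l)"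
    using qnorm_diff_le[OF s l] qnorm_diff_le[OF l s] s l by (simp add: abs_le_iff qnorm_diff_commute)
qed simp

text \<open>
  The uniform boundedness principle by a sliding-hump argument. If \<open>w n \<in> W\<close> has norm above \<open>4 ^ n\<close>,
  then from any point one can move by \<open>(1/3) ^ n\<close>, along or against \<open>w n\<close>, to a point
  where \<open>w n\<close> has inner product of size at least \<open>(1/3) ^ n \<parallel>w n\<parallel>\<close>. All later moves together have length at
  most half of \<open>(1/3) ^ n\<close>, so at the limit of these moves \<open>w n\<close> still takes a value
  of size at least \<open>(4/3) ^ n / 2\<close>.
\<close>

lemma weakly_bounded_imp_bounded:
  assumes W: "W \<subseteq> carrier H"
    and weak: "\<And>x. x \<in> carrier H \<Longrightarrow> \<exists>b. \<forall>w\<in>W. norm (qinner H w x) \<le> b"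
  shows "\<exists>b. \<forall>w\<in>W. qnorm H w \<le> b"
proof (rule ccontr)
  assume "\<not> ?thesis"
  then have "\<forall>n::nat. \<exists>w\<in>W. 4 ^ n < qnorm H w" by (meson not_le)
  then obtain w where wW: "\<And>n::nat. w n \<in> W" and wbig: "\<And>n. 4 ^ n < qnorm H (w n)"
    by metis
  have w [simp]: "w n \<in> carrier H" for n using wW W by blast
  have "\<exists>y. y \<in> carrier H \<and> qnorm H (y \<ominus> x) \<le> (1/3) ^ n \<and>
      (1/3) ^ n * qnorm H (w n) \<le> norm (qinner H (w n) y)"
    if x: "x \<in> carrier H" for x n
  proof -
    define r where "r = (1/3) ^ n / qnorm H (w n)"
    have wpos: "qnorm H (w n) > 0" using wbig[of n] by (rule less_trans[rotated]) simp
    define d where "d = qscale H (w n) (of_real r)"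
    have d [simp]: "d \<in> carrier H" by (simp add: d_def scale_closed)
    have nd: "qnorm H d = (1/3) ^ n"
      using wpos by (simp add: d_def qnorm_scale r_def del: of_real_divide of_real_power)
    have ip: "norm (qinner H (w n) d) = (1/3) ^ n * qnorm H (w n)"
    proof -
      have "qinner H (w n) d = of_real ((qnorm H (w n))\<^sup>2 * r)"
        by (simp add: d_def inner_scale inner_self)
      then show ?thesis
        using wpos by (simp only: norm_of_real) (simp add: r_def power2_eq_square)
    qed
    have "x \<oplus> d \<ominus> x = d" "qnorm H (x \<ominus> d \<ominus> x) = qnorm H d"
    proof -
      show "x \<oplus> d \<ominus> x = d" by (rule vector_eqI) (use x in \<open>simp_all add: inner_linear\<close>)
      show "qnorm H (x \<ominus> d \<ominus> x) = qnorm H d"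
        using x by (simp add: qnorm_def inner_linear)
    qed
    \<comment> \<open>The inner products with \<open>x + d\<close> and \<open>x - d\<close> differ by twice that with \<open>d\<close>, so one of them is large.\<close>
    moreover have "2 * norm (qinner H (w n) d) \<le>
        norm (qinner H (w n) (x \<oplus> d)) + norm (qinner H (w n) (x \<ominus> d))"
      using norm_triangle_ineq4[of "qinner H (w n) (x \<oplus> d)" "qinner H (w n) (x \<ominus> d)"] x
      by (simp add: inner_linear norm_mult flip: mult_2)
    ultimately show ?thesis
      using ip nd x
      by (cases "norm (qinner H (w n) d) \<le> norm (qinner H (w n) (x \<oplus> d))")
        (force intro!: exI[of _ "x \<oplus> d"], force intro!: exI[of _ "x \<ominus> d"])
  qed
  then have step: "\<exists>y. y \<in> carrier H \<and> (qnorm H (y \<ominus> x) \<le> (1/3) ^ n \<and>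
      (1/3) ^ n * qnorm H (w n) \<le> norm (qinner H (w n) y))" if "x \<in> carrier H" for x n
    using that by blast
  obtain x where x [simp]: "\<And>n. x n \<in> carrier H"
    and close: "\<And>n. qnorm H (x (Suc n) \<ominus> x n) \<le> (1/3) ^ n"
    and big: "\<And>n. (1/3) ^ n * qnorm H (w n) \<le> norm (qinner H (w n) (x (Suc n)))"
    using dependent_nat_choice[of "\<lambda>n x. x \<in> carrier H"
        "\<lambda>n x y. qnorm H (y \<ominus> x) \<le> (1/3) ^ n \<and> (1/3) ^ n * qnorm H (w n) \<le> norm (qinner H (w n) y)",
        OF exI[of _ "\<zero>"] step] by auto
  \<comment> \<open>The right-hand side is the exact geometric sum of the step bounds.\<close>
  have dist: "qnorm H (x (n + k) \<ominus> x n) \<le> 3/2 * (1/3) ^ n - 3/2 * (1/3) ^ (n + k)" for n k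
  proof (induction k)
    case 0
    then show ?case by (simp add: minus_eq r_neg)
  next
    case (Suc k)
    have "qnorm H (x (n + Suc k) \<ominus> x n) \<le>
        qnorm H (x (Suc (n + k)) \<ominus> x (n + k)) + qnorm H (x (n + k) \<ominus> x n)"
      by (simp add: qnorm_diff_triangle)
    also have "\<dots> \<le> 3/2 * (1/3) ^ n - 3/2 * (1/3) ^ (n + Suc k)"
      using Suc close[of "n + k"] unfolding add_Suc_right power_Suc by linarith
    finally show ?case .
  qed
  have dist': "qnorm H (x m \<ominus> x n) \<le> 3/2 * (1/3) ^ n" if "n \<le> m" for m n
  proof -
    have "qnorm H (x m \<ominus> x n) \<le> 3/2 * (1/3) ^ n - 3/2 * (1/3) ^ m"
      using dist[of n "m - n"] that by simp
    moreover have "0 \<le> 3/2 * (1/3::real) ^ m" by simp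
    ultimately show ?thesis by linarith
  qed
  have "\<exists>l\<in>carrier H. (\<lambda>n. qnorm H (x n \<ominus> l)) \<longlonglongrightarrow> 0"
  proof (rule complete)
    fix e :: real assume "0 < e"
    have "(\<lambda>n. 3 * (1/3::real) ^ n) \<longlonglongrightarrow> 0"
      by (intro tendsto_mult_right_zero LIMSEQ_power_zero) simp
    with \<open>0 < e\<close> obtain N where N: "3 * (1/3::real) ^ N < e"
      by (metis eventually_sequentially order_refl order_tendstoD(2))
    show "\<exists>N. \<forall>m\<ge>N. \<forall>n\<ge>N. qnorm H (x m \<ominus> x n) < e"
    proof (intro exI allI impI)
      fix m n assume "N \<le> m" "N \<le> n"
      then have "qnorm H (x m \<ominus> x n) \<le> 3/2 * (1/3) ^ N + 3/2 * (1/3) ^ N"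
        using qnorm_diff_triangle[of "x m" "x N" "x n"] dist'[of N m] dist'[of N n]
          qnorm_diff_commute[of "x N" "x n"] by simp
      then show "qnorm H (x m \<ominus> x n) < e" using N by simp
    qed
  qed simp
  then obtain l where l [simp]: "l \<in> carrier H" and lim: "(\<lambda>n. qnorm H (x n \<ominus> l)) \<longlonglongrightarrow> 0"
    by blast
  have far: "1/2 * (1/3) ^ n * qnorm H (w n) \<le> norm (qinner H (w n) l)" for n
  proof -
    have "1/2 * (1/3) ^ n * qnorm H (w n) \<le> norm (qinner H (w n) (x (Suc n + k)))" for k
    proof -
      have "norm (qinner H (w n) (x (Suc n))) - norm (qinner H (w n) (x (Suc n + k)))
          \<le> norm (qinner H (w n) (x (Suc n + k) \<ominus> x (Suc n)))"
        using norm_triangle_ineq3[of "qinner H (w n) (x (Suc n))" "qinner H (w n) (x (Suc n + k))"]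
        by (simp add: inner_diff norm_minus_commute)
      also have "\<dots> \<le> qnorm H (w n) * qnorm H (x (Suc n + k) \<ominus> x (Suc n))"
        by (simp add: Cauchy_Schwarz)
      also have "\<dots> \<le> qnorm H (w n) * (3/2 * (1/3) ^ Suc n)"
        by (intro mult_left_mono dist') auto
      finally show ?thesis using big[of n] by (simp add: algebra_simps)
    qed
    moreover have "(\<lambda>k. norm (qinner H (w n) (x (Suc n + k)))) \<longlonglongrightarrow> norm (qinner H (w n) l)"
      using LIMSEQ_ignore_initial_segment[OF tendsto_norm[OF inner_tendsto[OF x l w lim]], of n "Suc n"]
      by (simp add: add.commute)
    ultimately show ?thesis by (intro LIMSEQ_le_const) auto
  qed
  obtain b where b: "\<And>n. norm (qinner H (w n) l) \<le> b" using weak[OF l] wW by blast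
  have "(4/3) ^ n \<le> 2 * b" for n
  proof -
    have "1/2 * (1/3) ^ n * 4 ^ n \<le> 1/2 * (1/3) ^ n * qnorm H (w n)"
      using wbig[of n] by (intro mult_left_mono) auto
    also have "\<dots> \<le> b" using far[of n] b[of n] by linarith
    finally show ?thesis by (simp add: power_divide)
  qed
  moreover obtain n where "2 * b < (4/3) ^ n"
    using real_arch_pow[of "4/3" "2 * b"] by auto
  ultimately show False by (meson not_le)
qed

end

section \<open>Bounded operators, the Riesz theorem and adjoints\<close>

locale quat_operator = H: right_quat_hilbert_space H + G: right_quat_hilbert_space G
  for H :: "'a quat_space" and G :: "'b quat_space" +
  fixes L :: "'a \<Rightarrow> 'b"
  assumes bounded: "L \<in> bounded_ops H G"
begin

lemma extensional [simp]: "L \<in> extensional (carrier H)"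
  and closed [simp]: "u \<in> carrier H \<Longrightarrow> L u \<in> carrier G"
  and map_add: "\<lbrakk>u \<in> carrier H; v \<in> carrier H\<rbrakk> \<Longrightarrow> L (u \<oplus>\<^bsub>H\<^esub> v) = L u \<oplus>\<^bsub>G\<^esub> L v"
  and map_scale: "u \<in> carrier H \<Longrightarrow> L (qscale H u q) = qscale G (L u) q"
  using bounded by (auto simp: bounded_ops_def PiE_def Pi_def)

lemma bound: "\<exists>C\<ge>0. \<forall>u\<in>carrier H. qnorm G (L u) \<le> C * qnorm H u"
proof -
  obtain C where C: "\<forall>u\<in>carrier H. qnorm G (L u) \<le> C * qnorm H u"
    using bounded unfolding bounded_ops_def by blast
  have "qnorm G (L u) \<le> max C 0 * qnorm H u" if "u \<in> carrier H" for u
    using C that by (meson H.qnorm_nonneg max.cobounded1 mult_right_mono order_trans)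
  then show ?thesis by (intro exI[of _ "max C 0"]) auto
qed

text \<open>
  If \<open>g\<close> represents \<open>\<psi>\<close>, completing the square gives \<open>\<parallel>L u\<parallel>\<^sup>2 - 2 Re (\<psi> u) = \<parallel>L u - g\<parallel>\<^sup>2 - \<parallel>g\<parallel>\<^sup>2\<close>, so
  minimizing the left-hand side \<open>J u\<close> drives \<open>L u\<close> to \<open>g\<close> when \<open>g\<close> is in the closure of the range of \<open>L\<close>. This is
  how \<open>g\<close> is found: by the parallelogram law the images \<open>L (s n)\<close> of a minimizing sequence are Cauchy,
  although \<open>s\<close> itself need not converge, and a first variation at their limit yields the
  representation. The last clause places \<open>g\<close> in the closure of the range of \<open>L\<close>. It
  is stated as double orthogonality because in this form it is evidently preserved by linear
  combinations, and it makes \<open>g\<close> unique.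
\<close>

lemma functional_on_range_representable:
  fixes \<psi> :: "'a \<Rightarrow> quat"
  assumes add: "\<And>u v. \<lbrakk>u \<in> carrier H; v \<in> carrier H\<rbrakk> \<Longrightarrow> \<psi> (u \<oplus>\<^bsub>H\<^esub> v) = \<psi> u + \<psi> v"
    and scale: "\<And>u q. u \<in> carrier H \<Longrightarrow> \<psi> (qscale H u q) = \<psi> u * q"
    and bnd: "\<And>u. u \<in> carrier H \<Longrightarrow> norm (\<psi> u) \<le> C * qnorm G (L u)" and C: "C \<ge> 0"
  shows "\<exists>g\<in>carrier G. (\<forall>u\<in>carrier H. qinner G g (L u) = \<psi> u) \<and> qnorm G g \<le> C \<and>
    (\<forall>z\<in>carrier G. (\<forall>u\<in>carrier H. qinner G z (L u) = 0) \<longrightarrow> qinner G z g = 0)"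
proof -
  define J where "J u = (qnorm G (L u))\<^sup>2 - 2 * qRe (\<psi> u)" for u
  have J_lower: "- C\<^sup>2 \<le> J u" if u: "u \<in> carrier H" for u
  proof -
    have "qRe (\<psi> u) \<le> C * qnorm G (L u)"
      using bnd[OF u] qRe_le_norm[of "\<psi> u"] by linarith
    moreover have "0 \<le> (qnorm G (L u) - C)\<^sup>2" by simp
    ultimately show ?thesis by (simp add: J_def power2_diff mult.commute)
  qed
  define m where "m = Inf (J ` carrier H)"
  have bdd: "bdd_below (J ` carrier H)" using J_lower by (auto intro!: bdd_belowI)
  have m_le: "m \<le> J u" if "u \<in> carrier H" for u
    unfolding m_def using that bdd by (auto intro: cInf_lower)
  have "\<exists>u\<in>carrier H. J u < m + 1 / real (Suc n)" for n
    using cInf_lessD[of "J ` carrier H" "m + 1 / real (Suc n)"] by (auto simp: m_def)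
  then obtain s where s [simp]: "\<And>n. s n \<in> carrier H" and Js: "\<And>n. J (s n) < m + 1 / real (Suc n)"
    by metis
  have J_combine: "J (u \<oplus>\<^bsub>H\<^esub> qscale H w (of_real t)) =
      J u + 2 * t * (qRe (qinner G (L u) (L w)) - qRe (\<psi> w)) + t\<^sup>2 * (qnorm G (L w))\<^sup>2"
    if "u \<in> carrier H" "w \<in> carrier H" for u w t
    using that
    by (simp add: J_def map_add map_scale add scale H.scale_closed G.qnorm_add_sq G.scale_closed
        G.inner_scale G.qnorm_scale power_mult_distrib algebra_simps)
  have parallelogram: "(qnorm G (L u \<ominus>\<^bsub>G\<^esub> L v))\<^sup>2 \<le> 2 * (J u - m) + 2 * (J v - m)"
    if u: "u \<in> carrier H" and v: "v \<in> carrier H" for u v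
  proof -
    define c where "c = qscale H (u \<oplus>\<^bsub>H\<^esub> v) (of_real (1/2))"
    have "c \<in> carrier H" using u v by (simp add: c_def H.scale_closed)
    have "4 * J c = 2 * J u + 2 * J v - (qnorm G (L u \<ominus>\<^bsub>G\<^esub> L v))\<^sup>2"
      using u v G.inner_cnj[of "L v" "L u"]
      by (simp add: c_def J_def map_add map_scale add scale G.qnorm_scale G.qnorm_sq
          G.inner_linear power_mult_distrib del: of_real_divide)
        (simp add: G.qnorm_sq G.inner_linear field_simps)
    moreover have "4 * m \<le> 4 * J c" using m_le[OF \<open>c \<in> carrier H\<close>] by simp
    ultimately show ?thesis by (simp add: algebra_simps)
  qed
  have close: "(qnorm G (L (s i) \<ominus>\<^bsub>G\<^esub> L (s j)))\<^sup>2 \<le> 2 / real (Suc i) + 2 / real (Suc j)" for i j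
    using parallelogram[of "s i" "s j"] Js[of i] Js[of j] by simp
  have "\<exists>g\<in>carrier G. (\<lambda>n. qnorm G (L (s n) \<ominus>\<^bsub>G\<^esub> g)) \<longlonglongrightarrow> 0"
  proof (rule G.complete)
    fix e :: real assume e: "0 < e"
    then obtain N where N: "inverse (real (Suc N)) < e\<^sup>2 / 4" using reals_Archimedean[of "e\<^sup>2 / 4"] by auto
    show "\<exists>N. \<forall>i\<ge>N. \<forall>j\<ge>N. qnorm G (L (s i) \<ominus>\<^bsub>G\<^esub> L (s j)) < e"
    proof (intro exI allI impI)
      fix i j assume "N \<le> i" "N \<le> j"
      then have "2 / real (Suc i) \<le> 2 / real (Suc N)" "2 / real (Suc j) \<le> 2 / real (Suc N)"
        by (auto intro!: divide_left_mono)
      then have "(qnorm G (L (s i) \<ominus>\<^bsub>G\<^esub> L (s j)))\<^sup>2 < e\<^sup>2"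
        using close[of i j] N by (simp add: inverse_eq_divide)
      then show "qnorm G (L (s i) \<ominus>\<^bsub>G\<^esub> L (s j)) < e" using e by (simp add: power_less_imp_less_base)
    qed
  qed simp
  then obtain g where g [simp]: "g \<in> carrier G"
    and lim: "(\<lambda>n. qnorm G (L (s n) \<ominus>\<^bsub>G\<^esub> g)) \<longlonglongrightarrow> 0" by blast
  note tends = G.inner_tendsto[OF closed[OF s] g _ lim]
  have qRe_lim: "(\<lambda>n. qRe (f n)) \<longlonglongrightarrow> qRe l" if "f \<longlonglongrightarrow> l" for f l
    using tendsto_inner[OF that tendsto_const[of "1::quat"]] by (simp add: inner_quat_def one_quat_def)
  have qRe_eq: "qRe (qinner G g (L w)) = qRe (\<psi> w)" if w: "w \<in> carrier H" for w
  proof -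
    define a where "a = qRe (qinner G g (L w)) - qRe (\<psi> w)"
    define b where "b = (qnorm G (L w))\<^sup>2"
    have variation: "0 \<le> 2 * t * a + t\<^sup>2 * b" for t
    proof -
      have lower: "- (1 / real (Suc n)) \<le>
          2 * t * (qRe (qinner G (L w) (L (s n))) - qRe (\<psi> w)) + t\<^sup>2 * b" for n
        using m_le[of "s n \<oplus>\<^bsub>H\<^esub> qscale H w (of_real t)"] J_combine[of "s n" w t] Js[of n] w
          G.inner_cnj[of "L w" "L (s n)"]
        by (simp add: H.scale_closed b_def)
      have upper: "(\<lambda>n. 2 * t * (qRe (qinner G (L w) (L (s n))) - qRe (\<psi> w)) + t\<^sup>2 * b)
          \<longlonglongrightarrow> 2 * t * (qRe (qinner G (L w) g) - qRe (\<psi> w)) + t\<^sup>2 * b"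
        by (intro tendsto_intros qRe_lim tends) (simp add: w)
      have "(\<lambda>n. - (1 / real (Suc n))) \<longlonglongrightarrow> - 0"
        by (intro tendsto_minus) (use LIMSEQ_inverse_real_of_nat in \<open>simp add: inverse_eq_divide\<close>)
      from LIMSEQ_le[OF this upper] lower show ?thesis
        using w G.inner_cnj[of "L w" g] by (simp add: a_def)
    qed
    have "b \<ge> 0" by (simp add: b_def)
    \<comment> \<open>The parabola in \<open>t\<close> is minimal at \<open>t = - a / b\<close>; adding one to the denominator covers \<open>b = 0\<close>.\<close>
    define d where "d = b + 1"
    have "d > 0" and b_eq: "b = d - 1" using \<open>b \<ge> 0\<close> by (simp_all add: d_def)
    have "2 * (- a / d) * a + (- a / d)\<^sup>2 * b = - (a / d)\<^sup>2 * (d + 1)"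
      using \<open>d > 0\<close> unfolding b_eq by (simp add: field_simps power2_eq_square)
    with variation[of "- a / d"] have "(a / d)\<^sup>2 * (d + 1) \<le> 0" by simp
    then have "a = 0" using \<open>d > 0\<close> by (simp add: mult_le_0_iff)
    then show ?thesis by (simp add: a_def)
  qed
  have rep: "qinner G g (L u) = \<psi> u" if u: "u \<in> carrier H" for u
  proof (rule quat_eqI_qRe)
    fix r
    show "qRe (qinner G g (L u) * r) = qRe (\<psi> u * r)"
      using qRe_eq[of "qscale H u r"] u by (simp add: H.scale_closed map_scale scale G.inner_scale)
  qed
  have "(qnorm G g)\<^sup>2 \<le> C * qnorm G g"
  proof (rule LIMSEQ_le)
    show "(\<lambda>n. qRe (qinner G g (L (s n)))) \<longlonglongrightarrow> (qnorm G g)\<^sup>2"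
      using qRe_lim[OF tends[OF g]] by (simp add: G.qnorm_sq)
    show "(\<lambda>n. C * qnorm G (L (s n))) \<longlonglongrightarrow> C * qnorm G g"
      by (intro tendsto_intros G.qnorm_tendsto lim) auto
    show "\<exists>N. \<forall>n\<ge>N. qRe (qinner G g (L (s n))) \<le> C * qnorm G (L (s n))"
      using rep bnd qRe_le_norm order_trans s by metis
  qed
  then have "qnorm G g \<le> C"
    using C G.qnorm_nonneg[OF g] by (cases "qnorm G g = 0") (auto simp: power2_eq_square)
  moreover have "qinner G z g = 0"
    if z: "z \<in> carrier G" and orth: "\<forall>u\<in>carrier H. qinner G z (L u) = 0" for z
    using LIMSEQ_unique[OF tends[OF z]] orth by simp
  ultimately show ?thesis using rep g by blast
qed

end

context right_quat_hilbert_space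
begin

lemma identity_operator: "quat_operator H H (\<lambda>u\<in>carrier H. u)"
  by unfold_locales (auto simp: bounded_ops_def scale_closed intro!: exI[of _ 1])

lemma Riesz_representation:
  assumes "\<And>u v. \<lbrakk>u \<in> carrier H; v \<in> carrier H\<rbrakk> \<Longrightarrow> \<psi> (u \<oplus> v) = \<psi> u + \<psi> v"
    and "\<And>u q. u \<in> carrier H \<Longrightarrow> \<psi> (qscale H u q) = \<psi> u * q"
    and "\<And>u. u \<in> carrier H \<Longrightarrow> norm (\<psi> u) \<le> C * qnorm H u" and "C \<ge> 0"
  shows "\<exists>g\<in>carrier H. \<forall>u\<in>carrier H. qinner H g u = \<psi> u"
  using quat_operator.functional_on_range_representable[OF identity_operator, of \<psi> C] assms by auto

end

context quat_operator
begin

lemma adjoint_exists: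
  "\<exists>A. A \<in> bounded_ops G H \<and>
    (\<forall>u\<in>carrier H. \<forall>v\<in>carrier G. qinner G (L u) v = qinner H u (A v))"
proof -
  obtain C where C: "C \<ge> 0" "\<And>u. u \<in> carrier H \<Longrightarrow> qnorm G (L u) \<le> C * qnorm H u"
    using bound by auto
  have "\<exists>a\<in>carrier H. \<forall>u\<in>carrier H. qinner H a u = qinner G v (L u)" if v: "v \<in> carrier G" for v
  proof (rule H.Riesz_representation)
    show "norm (qinner G v (L u)) \<le> (qnorm G v * C) * qnorm H u" if u: "u \<in> carrier H" for u
      using G.Cauchy_Schwarz[OF v closed[OF u]] mult_left_mono[OF C(2)[OF u] G.qnorm_nonneg[OF v]]
      by (simp add: mult.assoc)
  qed (use v C(1) in \<open>simp_all add: map_add map_scale G.inner_linear\<close>)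
  then obtain A0 where A0: "\<And>v. v \<in> carrier G \<Longrightarrow> A0 v \<in> carrier H"
    and A0_rep: "\<And>u v. \<lbrakk>v \<in> carrier G; u \<in> carrier H\<rbrakk> \<Longrightarrow> qinner H (A0 v) u = qinner G v (L u)"
    by metis
  define A where "A = restrict A0 (carrier G)"
  have A [simp]: "A v \<in> carrier H" if "v \<in> carrier G" for v
    using that A0 by (simp add: A_def)
  have rel: "qinner H u (A v) = qinner G (L u) v" if "u \<in> carrier H" "v \<in> carrier G" for u v
    using that A0[of v] A0_rep[of v u] H.inner_cnj[of u "A v"] G.inner_cnj[of "L u" v]
    by (simp add: A_def)
  have "A (v \<oplus>\<^bsub>G\<^esub> w) = A v \<oplus>\<^bsub>H\<^esub> A w" if "v \<in> carrier G" "w \<in> carrier G" for v w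
    by (rule H.vector_eqI) (use that in \<open>simp_all add: rel H.inner_linear G.inner_linear\<close>)
  moreover have "A (qscale G v q) = qscale H (A v) q" if "v \<in> carrier G" for v q
    by (rule H.vector_eqI) (use that in \<open>simp_all add: rel H.inner_linear G.inner_linear\<close>)
  moreover have "qnorm H (A v) \<le> C * qnorm G v" if v: "v \<in> carrier G" for v
  proof -
    have "qnorm H (A v) * qnorm H (A v) = qRe (qinner G (L (A v)) v)"
      using v rel[of "A v" v] H.qnorm_sq[of "A v"] by (simp add: power2_eq_square)
    also have "\<dots> \<le> qnorm G (L (A v)) * qnorm G v"
      using v by (simp add: G.qRe_inner_le)
    also have "\<dots> \<le> (C * qnorm H (A v)) * qnorm G v"
      using v C(2)[of "A v"] by (simp add: mult_right_mono)
    finally have "qnorm H (A v) * qnorm H (A v) \<le> qnorm H (A v) * (C * qnorm G v)"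
      by (simp add: algebra_simps)
    then show ?thesis
      using v C(1) by (cases "qnorm H (A v) = 0") (auto simp: order_less_le)
  qed
  moreover have "A \<in> extensional (carrier G)" by (simp add: A_def)
  ultimately have "A \<in> bounded_ops G H"
    by (auto simp: bounded_ops_def PiE_def intro!: exI[of _ C])
  then show ?thesis using rel by auto
qed

lemma adjoint_bounded: "op_adjoint H G L \<in> bounded_ops G H" (is ?bounded)
  and inner_adjoint: "\<lbrakk>u \<in> carrier H; v \<in> carrier G\<rbrakk> \<Longrightarrow>
    qinner H u (op_adjoint H G L v) = qinner G (L u) v"
proof -
  let ?P = "\<lambda>A. A \<in> bounded_ops G H \<and>
    (\<forall>u\<in>carrier H. \<forall>v\<in>carrier G. qinner G (L u) v = qinner H u (A v))"
  have "A = B" if A: "?P A" and B: "?P B" for A B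
  proof (rule extensionalityI)
    show "A v = B v" if v: "v \<in> carrier G" for v
    proof (rule H.vector_eqI)
      show "A v \<in> carrier H" "B v \<in> carrier H"
        using A B v by (auto simp: bounded_ops_def PiE_def)
      show "qinner H z (A v) = qinner H z (B v)" if "z \<in> carrier H" for z
        using A B v that by metis
    qed
  qed (use A B in \<open>auto simp: bounded_ops_def PiE_def\<close>)
  with adjoint_exists have "\<exists>!A. ?P A" by blast
  then have "?P (op_adjoint H G L)" unfolding op_adjoint_def by (rule theI')
  then show ?bounded
    and "\<lbrakk>u \<in> carrier H; v \<in> carrier G\<rbrakk> \<Longrightarrow> qinner H u (op_adjoint H G L v) = qinner G (L u) v"
    by auto
qed

lemma adjoint_operator: "quat_operator G H (op_adjoint H G L)"
  by unfold_locales (rule adjoint_bounded)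

lemma adjoint_closed [simp]: "v \<in> carrier G \<Longrightarrow> op_adjoint H G L v \<in> carrier H"
  using quat_operator.closed[OF adjoint_operator] .

lemma inner_adjoint_left:
  "\<lbrakk>u \<in> carrier H; v \<in> carrier G\<rbrakk> \<Longrightarrow> qinner H (op_adjoint H G L v) u = qinner G v (L u)"
  using inner_adjoint[of u v] H.inner_cnj[of "op_adjoint H G L v" u] G.inner_cnj[of v "L u"] by simp

end

section \<open>Douglas' factorization theorem\<close>

locale common_codomain = K: quat_operator E H K + L: quat_operator H G L
  for E :: "'e quat_space" and H :: "'a quat_space" and G :: "'b quat_space" and K L
begin

abbreviation "K_adj \<equiv> op_adjoint E H K"
abbreviation "L_adj \<equiv> op_adjoint H G L"

text \<open>
  For \<open>K x = L* g\<close> the number \<open>\<parallel>g\<parallel>\<close> bounds \<open>|\<langle>K* u, x\<rangle>| = |\<langle>L u, g\<rangle>|\<close> uniformly over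
  \<open>\<parallel>L u\<parallel> \<le> 1\<close>. No control of \<open>\<parallel>g\<parallel>\<close> in terms of \<open>x\<close> is available, which is why the uniform
  boundedness principle enters.
\<close>

lemma range_inclusion_imp_majorization:
  assumes "K ` carrier E \<subseteq> L_adj ` carrier G"
  shows "\<exists>c>0. \<forall>u\<in>carrier H. c * (qnorm E (K_adj u))\<^sup>2 \<le> (qnorm G (L u))\<^sup>2"
proof -
  define W where "W = K_adj ` {u \<in> carrier H. qnorm G (L u) \<le> 1}"
  have "\<exists>b. \<forall>w\<in>W. norm (qinner E w x) \<le> b" if x: "x \<in> carrier E" for x
  proof -
    obtain g where g: "g \<in> carrier G" "K x = L_adj g" using assms x by blast
    have "norm (qinner E (K_adj u) x) \<le> qnorm G g"
      if u: "u \<in> carrier H" "qnorm G (L u) \<le> 1" for u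
    proof -
      have "qinner E (K_adj u) x = qinner G (L u) g"
        using u x g by (simp add: K.inner_adjoint_left L.inner_adjoint)
      also have "norm \<dots> \<le> qnorm G (L u) * qnorm G g"
        using u g by (simp add: K.G.Cauchy_Schwarz L.G.Cauchy_Schwarz)
      also have "\<dots> \<le> 1 * qnorm G g" using u g by (intro mult_right_mono) auto
      finally show ?thesis by simp
    qed
    then show ?thesis by (auto simp: W_def)
  qed
  then have "\<exists>b. \<forall>w\<in>W. qnorm E w \<le> b"
    by (intro K.H.weakly_bounded_imp_bounded) (auto simp: W_def)
  then obtain b0 where b0: "\<And>u. \<lbrakk>u \<in> carrier H; qnorm G (L u) \<le> 1\<rbrakk> \<Longrightarrow> qnorm E (K_adj u) \<le> b0"
    by (auto simp: W_def)
  define b where "b = max b0 1"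
  have b: "b > 0" "\<And>u. \<lbrakk>u \<in> carrier H; qnorm G (L u) \<le> 1\<rbrakk> \<Longrightarrow> qnorm E (K_adj u) \<le> b"
    using b0 by (auto simp: b_def le_max_iff_disj)
  have scaled: "t * qnorm E (K_adj u) \<le> b" if u: "u \<in> carrier H" and t: "t \<ge> 0" "t * qnorm G (L u) \<le> 1" for t u
  proof -
    have "qnorm E (K_adj (qscale H u (of_real t))) \<le> b"
      using u t by (intro b) (simp_all add: K.G.scale_closed L.map_scale L.G.qnorm_scale mult.commute)
    then show ?thesis
      using u t by (simp add: quat_operator.map_scale[OF K.adjoint_operator] K.H.qnorm_scale mult.commute)
  qed
  have main: "qnorm E (K_adj u) \<le> b * qnorm G (L u)" if u: "u \<in> carrier H" for u
  proof (cases "qnorm G (L u) = 0")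
    case True
    \<comment> \<open>All positive multiples of \<open>u\<close> are then admissible, so \<open>b\<close> bounds all positive multiples of \<open>K* u\<close>.\<close>
    have "qnorm E (K_adj u) = 0"
    proof (rule ccontr)
      assume "qnorm E (K_adj u) \<noteq> 0"
      then show False
        using scaled[OF u, of "(b + 1) / qnorm E (K_adj u)"] True b(1) u by simp
    qed
    then show ?thesis using True by simp
  next
    case False
    then have "qnorm G (L u) > 0" using u by (simp add: order_less_le)
    then show ?thesis using scaled[OF u, of "1 / qnorm G (L u)"] by (simp add: field_simps)
  qed
  have "(1 / b\<^sup>2) * (qnorm E (K_adj u))\<^sup>2 \<le> (qnorm G (L u))\<^sup>2" if u: "u \<in> carrier H" for u
    using power_mono[OF main[OF u], of 2] u b(1) by (simp add: field_simps)
  then show ?thesis using b(1) by (intro exI[of _ "1 / b\<^sup>2"]) auto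
qed

text \<open>
  \<open>X v\<close> is the representative of \<open>L u \<mapsto> \<langle>K v, u\<rangle>\<close> in the closure of the range of \<open>L\<close>. Being unique
  there, it depends linearly on \<open>v\<close>, and \<open>\<langle>X v, L u\<rangle> = \<langle>K v, u\<rangle>\<close> for all \<open>u\<close> is the equation
  \<open>L* (X v) = K v\<close>.
\<close>

lemma majorization_imp_factorization:
  assumes c: "c > 0" and maj: "\<And>u. u \<in> carrier H \<Longrightarrow> c * (qnorm E (K_adj u))\<^sup>2 \<le> (qnorm G (L u))\<^sup>2"
  shows "\<exists>X\<in>bounded_ops E G. K = op_comp E L_adj X"
proof -
  define d where "d = 1 / sqrt c"
  have "d > 0" using c by (simp add: d_def)
  have K_adj_le: "qnorm E (K_adj u) \<le> d * qnorm G (L u)" if u: "u \<in> carrier H" for u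
  proof -
    have "sqrt c * qnorm E (K_adj u) \<le> qnorm G (L u)"
      using real_sqrt_le_mono[OF maj[OF u]] u by (simp add: real_sqrt_mult)
    then show ?thesis using c by (simp add: d_def field_simps)
  qed
  define fits where "fits v g \<longleftrightarrow> g \<in> carrier G \<and>
    (\<forall>u\<in>carrier H. qinner G g (L u) = qinner H (K v) u) \<and>
    (\<forall>z\<in>carrier G. (\<forall>u\<in>carrier H. qinner G z (L u) = 0) \<longrightarrow> qinner G z g = 0)" for v g
  have fits_unique: "g = h" if g: "fits v g" and h: "fits v h" for v g h
  proof -
    have gh [simp]: "g \<in> carrier G" "h \<in> carrier G" using g h by (auto simp: fits_def)
    have "\<forall>u\<in>carrier H. qinner G (g \<ominus>\<^bsub>G\<^esub> h) (L u) = 0"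
      using g h by (simp add: fits_def L.G.inner_diff_left)
    then have "qinner G (g \<ominus>\<^bsub>G\<^esub> h) g = 0" "qinner G (g \<ominus>\<^bsub>G\<^esub> h) h = 0"
      using g h by (auto simp: fits_def)
    then have "qnorm G (g \<ominus>\<^bsub>G\<^esub> h) = 0" by (simp add: qnorm_def L.G.inner_diff)
    then have "g \<ominus>\<^bsub>G\<^esub> h = \<zero>\<^bsub>G\<^esub>" by (simp add: L.G.qnorm_eq_0_iff)
    then show ?thesis using L.G.eq_if_diff_zero by simp
  qed
  have "\<exists>g. fits v g \<and> qnorm G g \<le> qnorm E v * d" if v: "v \<in> carrier E" for v
  proof -
    have "norm (qinner H (K v) u) \<le> (qnorm E v * d) * qnorm G (L u)" if u: "u \<in> carrier H" for u
    proof -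
      have "norm (qinner H (K v) u) = norm (qinner E v (K_adj u))"
        using u v by (simp add: K.inner_adjoint)
      also have "\<dots> \<le> qnorm E v * qnorm E (K_adj u)" using u v by (simp add: K.H.Cauchy_Schwarz)
      also have "\<dots> \<le> qnorm E v * (d * qnorm G (L u))"
        using u v K_adj_le by (simp add: mult_left_mono)
      finally show ?thesis by (simp add: mult.assoc)
    qed
    then show ?thesis
      using L.functional_on_range_representable[of "\<lambda>u. qinner H (K v) u" "qnorm E v * d"] v \<open>d > 0\<close>
      by (auto simp: fits_def K.G.inner_linear)
  qed
  then obtain X0 where X0: "\<And>v. v \<in> carrier E \<Longrightarrow> fits v (X0 v)"
    and X0_le: "\<And>v. v \<in> carrier E \<Longrightarrow> qnorm G (X0 v) \<le> qnorm E v * d" by metis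
  define X where "X = restrict X0 (carrier E)"
  have X_fits: "fits v (X v)" if "v \<in> carrier E" for v using that X0 by (simp add: X_def)
  then have X_closed [simp]: "X v \<in> carrier G" if "v \<in> carrier E" for v using that by (simp add: fits_def)
  have "X (v \<oplus>\<^bsub>E\<^esub> w) = X v \<oplus>\<^bsub>G\<^esub> X w" if v: "v \<in> carrier E" and w: "w \<in> carrier E" for v w
  proof (rule fits_unique)
    show "fits (v \<oplus>\<^bsub>E\<^esub> w) (X (v \<oplus>\<^bsub>E\<^esub> w))" using v w by (simp add: X_fits)
    show "fits (v \<oplus>\<^bsub>E\<^esub> w) (X v \<oplus>\<^bsub>G\<^esub> X w)"
      using X_fits[OF v] X_fits[OF w] v w
      by (simp add: fits_def K.map_add K.G.inner_linear L.G.inner_linear)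
  qed
  moreover have "X (qscale E v q) = qscale G (X v) q" if v: "v \<in> carrier E" for v q
  proof (rule fits_unique)
    show "fits (qscale E v q) (X (qscale E v q))" using v by (simp add: X_fits K.H.scale_closed)
    show "fits (qscale E v q) (qscale G (X v) q)"
      using X_fits[OF v] v
      by (simp add: fits_def K.map_scale K.G.inner_linear L.G.inner_linear)
  qed
  moreover have "qnorm G (X v) \<le> d * qnorm E v" if "v \<in> carrier E" for v
    using that X0_le by (simp add: X_def mult.commute)
  moreover have "X \<in> extensional (carrier E)" by (simp add: X_def)
  ultimately have "X \<in> bounded_ops E G"
    by (auto simp: bounded_ops_def PiE_def intro!: exI[of _ d])
  moreover have "K = op_comp E L_adj X"
  proof (rule extensionalityI)
    show "K \<in> extensional (carrier E)" by simp
    show "op_comp E L_adj X \<in> extensional (carrier E)" by (simp add: op_comp_def)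
    show "K v = op_comp E L_adj X v" if v: "v \<in> carrier E" for v
    proof (rule K.G.vector_eqI)
      fix z assume z: "z \<in> carrier H"
      have "qinner G (X v) (L z) = qinner H (K v) z"
        using X_fits[OF v] z by (simp add: fits_def)
      then show "qinner H z (K v) = qinner H z (op_comp E L_adj X v)"
        using v z K.G.inner_cnj[of z "K v"] L.G.inner_cnj[of "L z" "X v"]
        by (simp add: op_comp_def compose_eq L.inner_adjoint)
    qed (use v in \<open>simp_all add: op_comp_def compose_eq\<close>)
  qed
  ultimately show ?thesis by blast
qed

lemma factorization_imp_range_inclusion:
  assumes "X \<in> bounded_ops E G" "K = op_comp E L_adj X"
  shows "K ` carrier E \<subseteq> L_adj ` carrier G"
  using assms by (auto simp: op_comp_def compose_eq bounded_ops_def)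

theorem Douglas_factorization:
  shows "K ` carrier E \<subseteq> L_adj ` carrier G \<longleftrightarrow>
      (\<exists>c>0. \<forall>u\<in>carrier H. c * (qnorm E (K_adj u))\<^sup>2 \<le> (qnorm G (L u))\<^sup>2)"
    and "(\<exists>X\<in>bounded_ops E G. K = op_comp E L_adj X) \<longleftrightarrow>
      (\<exists>c>0. \<forall>u\<in>carrier H. c * (qnorm E (K_adj u))\<^sup>2 \<le> (qnorm G (L u))\<^sup>2)"
  using range_inclusion_imp_majorization majorization_imp_factorization
    factorization_imp_range_inclusion by meson+

end

section \<open>Square-integrable quaternion-valued functions\<close>

lemma bounded_linear_qcnj: "bounded_linear qcnj"
  by (rule bounded_linear_intro[of _ 1]) (simp_all add: quat_eq_iff)

lemma borel_measurable_quat_mult [measurable (raw)]: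
  fixes f g :: "'w \<Rightarrow> quat"
  assumes "f \<in> borel_measurable M" "g \<in> borel_measurable M"
  shows "(\<lambda>w. f w * g w) \<in> borel_measurable M"
  using borel_measurable_continuous_Pair[OF assms, of "\<lambda>x y. x * y"] by (simp add: continuous_on_mult split_beta continuous_on_fst continuous_on_snd continuous_on_id)

lemma borel_measurable_qcnj [measurable (raw)]:
  "f \<in> borel_measurable M \<Longrightarrow> (\<lambda>w. qcnj (f w)) \<in> borel_measurable M"
  by (rule borel_measurable_continuous_on[OF linear_continuous_on[OF bounded_linear_qcnj]])

lemma norm_add_sq_le: "(norm (p + q))\<^sup>2 \<le> 2 * (norm p)\<^sup>2 + 2 * (norm (q::'x::real_normed_vector))\<^sup>2"
proof -
  have "(norm (p + q))\<^sup>2 \<le> (norm p + norm q)\<^sup>2" by (simp add: norm_triangle_ineq power_mono)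
  also have "\<dots> \<le> 2 * (norm p)\<^sup>2 + 2 * (norm q)\<^sup>2"
    using zero_le_power2[of "norm p - norm q"] by (simp add: power2_sum power2_diff)
  finally show ?thesis .
qed

lemma L2_fun_iff_nn_integral:
  "g \<in> L2_fun M \<longleftrightarrow> g \<in> borel_measurable M \<and> (\<integral>\<^sup>+ w. ennreal ((norm (g w))\<^sup>2) \<partial>M) < \<infinity>"
  by (auto simp: L2_fun_def integrable_iff_bounded)

lemma L2_fun_measurable [measurable_dest]: "g \<in> L2_fun M \<Longrightarrow> g \<in> borel_measurable M"
  by (simp add: L2_fun_def)

lemma L2_fun_zero [simp]: "(\<lambda>_. 0) \<in> L2_fun M"
  by (simp add: L2_fun_def)

lemma L2_fun_add: 
  assumes "g \<in> L2_fun M" "h \<in> L2_fun M"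
  shows "(\<lambda>w. g w + h w) \<in> L2_fun M"
proof -
  have "integrable M (\<lambda>w. (norm (g w + h w))\<^sup>2)"
  proof (rule Bochner_Integration.integrable_bound)
    show "integrable M (\<lambda>w. 2 * (norm (g w))\<^sup>2 + 2 * (norm (h w))\<^sup>2)"
      using assms by (simp add: L2_fun_def)
    show "AE w in M. norm ((norm (g w + h w))\<^sup>2) \<le> norm (2 * (norm (g w))\<^sup>2 + 2 * (norm (h w))\<^sup>2)"
      using norm_add_sq_le by (intro AE_I2) auto
  qed (use assms in measurable)
  then show ?thesis using assms by (simp add: L2_fun_def borel_measurable_add)
qed

lemma L2_fun_mult:
  assumes "g \<in> L2_fun M"
  shows "(\<lambda>w. g w * q) \<in> L2_fun M"
  using assms by (simp add: L2_fun_def norm_mult power_mult_distrib borel_measurable_quat_mult)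

lemma L2_fun_uminus: "g \<in> L2_fun M \<Longrightarrow> (\<lambda>w. - g w) \<in> L2_fun M"
  by (simp add: L2_fun_def)

lemma L2_fun_diff: "\<lbrakk>g \<in> L2_fun M; h \<in> L2_fun M\<rbrakk> \<Longrightarrow> (\<lambda>w. g w - h w) \<in> L2_fun M"
  using L2_fun_add[OF _ L2_fun_uminus, of g M h] by simp

lemma integrable_inner:
  assumes "g \<in> L2_fun M" "h \<in> L2_fun M"
  shows "integrable M (\<lambda>w. qcnj (g w) * h w)"
proof (rule Bochner_Integration.integrable_bound)
  show "integrable M (\<lambda>w. (norm (g w))\<^sup>2 + (norm (h w))\<^sup>2)"
    using assms by (simp add: L2_fun_def)
  have "norm p * norm q \<le> (norm p)\<^sup>2 + (norm q)\<^sup>2" for p q :: quat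
    using sum_squares_bound[of "norm p" "norm q"] mult_nonneg_nonneg[OF norm_ge_zero[of p] norm_ge_zero[of q]]
    by linarith
  then show "AE w in M. norm (qcnj (g w) * h w) \<le> norm ((norm (g w))\<^sup>2 + (norm (h w))\<^sup>2)"
    by (intro AE_I2) (simp add: norm_mult)
qed (use assms in measurable)

section \<open>The space of almost everywhere classes\<close>

lemma L2_rel_equiv: "equiv (L2_fun M) (L2_rel M)"
  by (rule equivI) (auto simp: refl_on_def sym_def trans_def L2_rel_def)

lemma L2_class_in [simp]: "g \<in> L2_fun M \<Longrightarrow> L2_class M g \<in> carrier (L2 M)"
  by (simp add: L2_def L2_class_def quotientI)

lemma L2_class_cases:
  assumes "G \<in> carrier (L2 M)"
  obtains g where "g \<in> L2_fun M" "G = L2_class M g"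
  using assms by (auto simp: L2_def L2_class_def elim: quotientE)

lemma L2_class_eq_iff:
  assumes "g \<in> L2_fun M" "h \<in> L2_fun M"
  shows "L2_class M g = L2_class M h \<longleftrightarrow> (AE w in M. g w = h w)"
  using eq_equiv_class_iff[OF L2_rel_equiv assms] assms by (simp add: L2_class_def L2_rel_def)

lemma L2_rep_class:
  assumes "g \<in> L2_fun M"
  shows "L2_rep (L2_class M g) \<in> L2_fun M" "AE w in M. L2_rep (L2_class M g) w = g w"
proof -
  have "g \<in> L2_class M g" using assms by (simp add: L2_class_def L2_rel_def)
  then have "L2_rep (L2_class M g) \<in> L2_class M g" unfolding L2_rep_def by (rule someI[of "\<lambda>f. f \<in> L2_class M g"])
  then have rel: "(g, L2_rep (L2_class M g)) \<in> L2_rel M" by (simp add: L2_class_def)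
  then show "L2_rep (L2_class M g) \<in> L2_fun M" by (simp add: L2_rel_def)
  have "AE w in M. g w = L2_rep (L2_class M g) w" using rel by (simp add: L2_rel_def)
  then show "AE w in M. L2_rep (L2_class M g) w = g w" by eventually_elim simp
qed

lemma L2_add_class:
  assumes g: "g \<in> L2_fun M" and h: "h \<in> L2_fun M"
  shows "L2_class M g \<oplus>\<^bsub>L2 M\<^esub> L2_class M h = L2_class M (\<lambda>w. g w + h w)"
proof -
  have "L2_class M (\<lambda>w. L2_rep (L2_class M g) w + L2_rep (L2_class M h) w) = L2_class M (\<lambda>w. g w + h w)"
    unfolding L2_class_eq_iff[OF L2_fun_add[OF L2_rep_class(1)[OF g] L2_rep_class(1)[OF h]] L2_fun_add[OF g h]]
    using L2_rep_class(2)[OF g] L2_rep_class(2)[OF h] by eventually_elim simp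
  then show ?thesis by (simp add: L2_def)
qed

lemma L2_scale_class:
  assumes g: "g \<in> L2_fun M"
  shows "qscale (L2 M) (L2_class M g) q = L2_class M (\<lambda>w. g w * q)"
proof -
  have "L2_class M (\<lambda>w. L2_rep (L2_class M g) w * q) = L2_class M (\<lambda>w. g w * q)"
    unfolding L2_class_eq_iff[OF L2_fun_mult[OF L2_rep_class(1)[OF g]] L2_fun_mult[OF g]]
    using L2_rep_class(2)[OF g] by eventually_elim simp
  then show ?thesis by (simp add: L2_def)
qed

lemma L2_inner_class:
  assumes g: "g \<in> L2_fun M" and h: "h \<in> L2_fun M"
  shows "qinner (L2 M) (L2_class M g) (L2_class M h) = (LINT w|M. qcnj (g w) * h w)"
proof -
  note [measurable] = L2_fun_measurable[OF g] L2_fun_measurable[OF h]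
    L2_fun_measurable[OF L2_rep_class(1)[OF g]] L2_fun_measurable[OF L2_rep_class(1)[OF h]]
  have "(LINT w|M. qcnj (L2_rep (L2_class M g) w) * L2_rep (L2_class M h) w) =
      (LINT w|M. qcnj (g w) * h w)"
  proof (rule integral_cong_AE)
    show "AE w in M. qcnj (L2_rep (L2_class M g) w) * L2_rep (L2_class M h) w = qcnj (g w) * h w"
      using L2_rep_class(2)[OF g] L2_rep_class(2)[OF h] by eventually_elim simp
  qed measurable
  then show ?thesis by (simp add: L2_def)
qed

lemma L2_zero_class: "\<zero>\<^bsub>L2 M\<^esub> = L2_class M (\<lambda>_. 0)"
  by (simp add: L2_def)

lemma L2_inner_self_class:
  assumes g: "g \<in> L2_fun M"
  shows "qinner (L2 M) (L2_class M g) (L2_class M g) = of_real (LINT w|M. (norm (g w))\<^sup>2)"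
  using g by (simp add: L2_inner_class qcnj_mult_self L2_fun_def del: of_real_power)

lemma L2_qnorm_class:
  assumes g: "g \<in> L2_fun M"
  shows "(qnorm (L2 M) (L2_class M g))\<^sup>2 = (LINT w|M. (norm (g w))\<^sup>2)"
  using g by (simp add: qnorm_def L2_inner_self_class)

lemma nn_integral_L2_class:
  assumes g: "g \<in> L2_fun M"
  shows "(\<integral>\<^sup>+ w. ennreal ((norm (g w))\<^sup>2) \<partial>M) = ennreal ((qnorm (L2 M) (L2_class M g))\<^sup>2)"
  using g by (subst nn_integral_eq_integral) (auto simp: L2_fun_def L2_qnorm_class)

lemma L2_abelian_group: "abelian_group (L2 M)"
proof (rule abelian_groupI)
  fix F G K assume "F \<in> carrier (L2 M)" "G \<in> carrier (L2 M)" "K \<in> carrier (L2 M)"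
  then obtain f g k where [simp]: "F = L2_class M f" "G = L2_class M g" "K = L2_class M k"
    and fg: "f \<in> L2_fun M" "g \<in> L2_fun M" "k \<in> L2_fun M" by (auto elim!: L2_class_cases)
  show "F \<oplus>\<^bsub>L2 M\<^esub> G \<oplus>\<^bsub>L2 M\<^esub> K = F \<oplus>\<^bsub>L2 M\<^esub> (G \<oplus>\<^bsub>L2 M\<^esub> K)"
    using fg by (simp add: L2_add_class L2_fun_add add.assoc)
next
  fix F G assume "F \<in> carrier (L2 M)" "G \<in> carrier (L2 M)"
  then obtain f g where [simp]: "F = L2_class M f" "G = L2_class M g"
    and fg: "f \<in> L2_fun M" "g \<in> L2_fun M" by (auto elim!: L2_class_cases)
  show "F \<oplus>\<^bsub>L2 M\<^esub> G \<in> carrier (L2 M)" "F \<oplus>\<^bsub>L2 M\<^esub> G = G \<oplus>\<^bsub>L2 M\<^esub> F"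
    using fg by (simp_all add: L2_add_class L2_fun_add add.commute)
next
  fix F assume "F \<in> carrier (L2 M)"
  then obtain f where [simp]: "F = L2_class M f" and f: "f \<in> L2_fun M" by (auto elim!: L2_class_cases)
  show "\<zero>\<^bsub>L2 M\<^esub> \<oplus>\<^bsub>L2 M\<^esub> F = F"
    using f by (simp add: L2_add_class L2_zero_class)
  show "\<exists>G\<in>carrier (L2 M). G \<oplus>\<^bsub>L2 M\<^esub> F = \<zero>\<^bsub>L2 M\<^esub>"
    using f L2_fun_uminus[OF f]
    by (intro bexI[of _ "L2_class M (\<lambda>w. - f w)"]) (simp_all add: L2_add_class L2_zero_class)
qed (simp add: L2_zero_class)

lemma L2_diff_class:
  assumes g: "g \<in> L2_fun M" and h: "h \<in> L2_fun M"
  shows "L2_class M g \<ominus>\<^bsub>L2 M\<^esub> L2_class M h = L2_class M (\<lambda>w. g w - h w)"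
proof -
  interpret abelian_group "L2 M" by (rule L2_abelian_group)
  have "\<ominus>\<^bsub>L2 M\<^esub> L2_class M h = L2_class M (\<lambda>w. - h w)"
    using h L2_fun_uminus[OF h] by (intro minus_equality) (simp_all add: L2_add_class L2_zero_class)
  then show ?thesis
    using g h L2_fun_uminus[OF h] by (simp add: minus_eq L2_add_class)
qed

section \<open>Completeness of the space of square-integrable functions\<close>

text \<open>
  The Riesz-Fischer theorem. Along \<open>h k = f (r k)\<close>, where the consecutive distances have squares at most
  \<open>(1/8) ^ k\<close>, the integrals of \<open>4 ^ k |h (k + 1) - h k|\<^sup>2\<close> are summable, so these terms tend to zero
  almost everywhere and the increments are eventually below \<open>(1/2) ^ k\<close> pointwise. Working with weighted
  squares avoids Minkowski's inequality for infinite sums. Fatou's lemma transfers the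
  Cauchy estimates to the pointwise limit.
\<close>

lemma L2_Cauchy_limit:
  fixes f :: "nat \<Rightarrow> 'w \<Rightarrow> quat"
  assumes f: "\<And>n. f n \<in> L2_fun M"
    and Cauchy: "\<And>e. 0 < e \<Longrightarrow> \<exists>N. \<forall>m\<ge>N. \<forall>n\<ge>N.
      (\<integral>\<^sup>+ w. ennreal ((norm (f m w - f n w))\<^sup>2) \<partial>M) \<le> ennreal e"
  shows "\<exists>l\<in>L2_fun M. (\<lambda>n. \<integral>\<^sup>+ w. ennreal ((norm (f n w - l w))\<^sup>2) \<partial>M) \<longlonglongrightarrow> 0"
proof -
  note [measurable] = L2_fun_measurable[OF f]
  have "\<exists>r. (\<forall>k. \<forall>m\<ge>r k. \<forall>n\<ge>r k.
      (\<integral>\<^sup>+ w. ennreal ((norm (f m w - f n w))\<^sup>2) \<partial>M) \<le> ennreal ((1/8) ^ k)) \<and>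
    (\<forall>k. r k \<le> r (Suc k))"
  proof -
    have "\<exists>N. \<forall>k. \<forall>m\<ge>N k. \<forall>n\<ge>N k.
        (\<integral>\<^sup>+ w. ennreal ((norm (f m w - f n w))\<^sup>2) \<partial>M) \<le> ennreal ((1/8) ^ k)"
      using Cauchy by (intro choice) auto
    then obtain N where N: "\<And>k m n. \<lbrakk>m \<ge> N k; n \<ge> N k\<rbrakk> \<Longrightarrow>
        (\<integral>\<^sup>+ w. ennreal ((norm (f m w - f n w))\<^sup>2) \<partial>M) \<le> ennreal ((1/8) ^ k)" by blast
    \<comment> \<open>Partial sums turn the thresholds into a nondecreasing sequence.\<close>
    have "N k \<le> (\<Sum>i\<le>k. N i)" for k by (rule member_le_sum) auto
    then show ?thesis
      by (intro exI[of _ "\<lambda>k. \<Sum>i\<le>k. N i"]) (auto intro!: N intro: order_trans)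
  qed
  then obtain r where r: "\<And>k m n. \<lbrakk>m \<ge> r k; n \<ge> r k\<rbrakk> \<Longrightarrow>
      (\<integral>\<^sup>+ w. ennreal ((norm (f m w - f n w))\<^sup>2) \<partial>M) \<le> ennreal ((1/8) ^ k)"
    and r_mono: "\<And>k. r k \<le> r (Suc k)" by blast
  define h where "h k = f (r k)" for k
  have [measurable]: "h k \<in> borel_measurable M" for k by (simp add: h_def)
  have fast: "(\<integral>\<^sup>+ w. ennreal ((norm (h (Suc k) w - h k w))\<^sup>2) \<partial>M) \<le> ennreal ((1/8) ^ k)" for k
    unfolding h_def using r_mono by (intro r) auto
  have "(\<integral>\<^sup>+ w. (\<Sum>k. ennreal (4 ^ k * (norm (h (Suc k) w - h k w))\<^sup>2)) \<partial>M)
      = (\<Sum>k. \<integral>\<^sup>+ w. ennreal (4 ^ k * (norm (h (Suc k) w - h k w))\<^sup>2) \<partial>M)"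
    by (rule nn_integral_suminf) measurable
  also have "\<dots> \<le> (\<Sum>k. ennreal ((1/2) ^ k))"
  proof (rule suminf_le)
    fix k
    have "(\<integral>\<^sup>+ w. ennreal (4 ^ k * (norm (h (Suc k) w - h k w))\<^sup>2) \<partial>M)
        = ennreal (4 ^ k) * (\<integral>\<^sup>+ w. ennreal ((norm (h (Suc k) w - h k w))\<^sup>2) \<partial>M)"
      by (subst nn_integral_cmult[symmetric]) (auto simp: ennreal_mult)
    also have "\<dots> \<le> ennreal (4 ^ k) * ennreal ((1/8) ^ k)" by (intro mult_left_mono fast) simp
    also have "\<dots> = ennreal ((1/2) ^ k)"
      by (simp add: ennreal_mult[symmetric] power_mult_distrib[symmetric])
    finally show "(\<integral>\<^sup>+ w. ennreal (4 ^ k * (norm (h (Suc k) w - h k w))\<^sup>2) \<partial>M) \<le> ennreal ((1/2) ^ k)" .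
  qed auto
  also have "\<dots> = ennreal (\<Sum>k. (1/2) ^ k)"
    by (rule suminf_ennreal2) (auto intro: summable_geometric)
  also have "\<dots> < \<infinity>" by simp
  finally have "AE w in M. (\<Sum>k. ennreal (4 ^ k * (norm (h (Suc k) w - h k w))\<^sup>2)) \<noteq> \<infinity>"
    by (intro nn_integral_PInf_AE) auto
  then have conv: "AE w in M. convergent (\<lambda>k. h k w)"
  proof eventually_elim
    case (elim w)
    then have "summable (\<lambda>k. 4 ^ k * (norm (h (Suc k) w - h k w))\<^sup>2)"
      by (intro summable_suminf_not_top) auto
    then have "(\<lambda>k. 4 ^ k * (norm (h (Suc k) w - h k w))\<^sup>2) \<longlonglongrightarrow> 0" by (rule summable_LIMSEQ_zero)
    then have "eventually (\<lambda>k. 4 ^ k * (norm (h (Suc k) w - h k w))\<^sup>2 < 1) sequentially"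
      by (rule order_tendstoD) simp
    then have "eventually (\<lambda>k. norm (h (Suc k) w - h k w) \<le> (1/2) ^ k) sequentially"
    proof eventually_elim
      case (elim k)
      have "(2 ^ k * norm (h (Suc k) w - h k w))\<^sup>2 \<le> 1\<^sup>2"
        using elim by (simp add: power_mult_distrib power_mult[symmetric] mult.commute[of k] power_mult)
      then have "2 ^ k * norm (h (Suc k) w - h k w) \<le> 1" by (rule power2_le_imp_le) simp
      then show ?case by (simp add: power_divide field_simps)
    qed
    then have "summable (\<lambda>k. h (Suc k) w - h k w)"
      by (rule summable_comparison_test_ev) (simp add: summable_geometric)
    then show "convergent (\<lambda>k. h k w)"
      unfolding summable_iff_convergent sum_lessThan_telescope[of "\<lambda>k. h k w"]
      using convergent_diff_const_right_iff[of "\<lambda>k. h k w" "h 0 w"] by blast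
  qed
  define l where "l w = lim (\<lambda>k. h k w)" for w
  have [measurable]: "l \<in> borel_measurable M"
    unfolding l_def by (rule borel_measurable_lim_metric) simp
  have h_tendsto: "AE w in M. (\<lambda>k. h k w) \<longlonglongrightarrow> l w"
    using conv by eventually_elim (simp add: l_def convergent_LIMSEQ_iff)
  have Fatou: "(\<integral>\<^sup>+ w. ennreal ((norm (f n w - l w))\<^sup>2) \<partial>M) \<le> ennreal ((1/8) ^ k)" if n: "n \<ge> r k" for n k
  proof -
    have "(\<integral>\<^sup>+ w. ennreal ((norm (f n w - l w))\<^sup>2) \<partial>M)
        = (\<integral>\<^sup>+ w. liminf (\<lambda>j. ennreal ((norm (f n w - h j w))\<^sup>2)) \<partial>M)"
    proof (rule nn_integral_cong_AE)
      show "AE w in M. ennreal ((norm (f n w - l w))\<^sup>2) = liminf (\<lambda>j. ennreal ((norm (f n w - h j w))\<^sup>2))"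
        using h_tendsto
      proof eventually_elim
        case (elim w)
        have "(\<lambda>j. ennreal ((norm (f n w - h j w))\<^sup>2)) \<longlonglongrightarrow> ennreal ((norm (f n w - l w))\<^sup>2)"
          by (intro tendsto_ennrealI tendsto_intros elim)
        then show ?case by (intro lim_imp_Liminf[symmetric]) simp
      qed
    qed
    also have "\<dots> \<le> liminf (\<lambda>j. \<integral>\<^sup>+ w. ennreal ((norm (f n w - h j w))\<^sup>2) \<partial>M)"
      by (rule nn_integral_liminf) measurable
    also have "\<dots> \<le> ennreal ((1/8) ^ k)"
    proof (rule Liminf_le)
      show "\<forall>\<^sub>F j in sequentially. (\<integral>\<^sup>+ w. ennreal ((norm (f n w - h j w))\<^sup>2) \<partial>M) \<le> ennreal ((1/8) ^ k)"
      proof (rule eventually_sequentiallyI[of k])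
        fix j assume "k \<le> j"
        then have "r k \<le> r j" using lift_Suc_mono_le[of r k j] r_mono by blast
        then show "(\<integral>\<^sup>+ w. ennreal ((norm (f n w - h j w))\<^sup>2) \<partial>M) \<le> ennreal ((1/8) ^ k)"
          unfolding h_def using n by (intro r) auto
      qed
    qed simp
    finally show ?thesis .
  qed
  \<comment> \<open>The difference \<open>f (r 0) - l\<close> is square-integrable, hence so is \<open>l\<close>.\<close>
  have "(\<integral>\<^sup>+ w. ennreal ((norm (f (r 0) w - l w))\<^sup>2) \<partial>M) < \<infinity>"
    using le_less_trans[OF Fatou[of 0 "r 0"]] by simp
  then have "(\<lambda>w. f (r 0) w - l w) \<in> L2_fun M" by (simp add: L2_fun_iff_nn_integral)
  from L2_fun_diff[OF f[of "r 0"] this] have "l \<in> L2_fun M" by simp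
  moreover have "(\<lambda>n. \<integral>\<^sup>+ w. ennreal ((norm (f n w - l w))\<^sup>2) \<partial>M) \<longlonglongrightarrow> 0"
  proof (rule order_tendstoI)
    fix e :: ennreal assume "0 < e"
    have "(\<lambda>k. ennreal ((1/8) ^ k)) \<longlonglongrightarrow> ennreal 0"
      by (intro tendsto_ennrealI LIMSEQ_power_zero) simp
    then have "eventually (\<lambda>k. ennreal ((1/8) ^ k) < e) sequentially"
      using \<open>0 < e\<close> by (intro order_tendstoD) auto
    then obtain k where "ennreal ((1/8) ^ k) < e" by (auto simp: eventually_sequentially)
    then show "\<forall>\<^sub>F n in sequentially. (\<integral>\<^sup>+ w. ennreal ((norm (f n w - l w))\<^sup>2) \<partial>M) < e"
      using Fatou[of k] by (intro eventually_sequentiallyI[of "r k"]) (blast intro: le_less_trans)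
  qed simp
  ultimately show ?thesis by blast
qed

theorem L2_right_quat_hilbert_space:
  fixes M :: "'w measure"
  shows "right_quat_hilbert_space (L2 M)"
proof -
  interpret abelian_group "L2 M" by (rule L2_abelian_group)
  show ?thesis
  proof unfold_locales
    fix U :: "('w \<Rightarrow> quat) set" and p q assume "U \<in> carrier (L2 M)"
    then obtain u where [simp]: "U = L2_class M u" and u: "u \<in> L2_fun M" by (auto elim!: L2_class_cases)
    show "qscale (L2 M) U q \<in> carrier (L2 M)"
      "qscale (L2 M) U (p + q) = qscale (L2 M) U p \<oplus>\<^bsub>L2 M\<^esub> qscale (L2 M) U q"
      "qscale (L2 M) U (p * q) = qscale (L2 M) (qscale (L2 M) U p) q"
      "qscale (L2 M) U 1 = U"
      using u by (simp_all add: L2_scale_class L2_add_class L2_fun_mult distrib_left mult.assoc)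
    assume "U \<noteq> \<zero>\<^bsub>L2 M\<^esub>"
    then have "\<not> (AE w in M. u w = 0)" using u by (simp add: L2_zero_class L2_class_eq_iff)
    then have "(LINT w|M. (norm (u w))\<^sup>2) \<noteq> 0"
      using u by (subst integral_nonneg_eq_0_iff_AE) (auto simp: L2_fun_def)
    then have "0 < (LINT w|M. (norm (u w))\<^sup>2)" by (simp add: order_less_le)
    then show "0 < qinner (L2 M) U U"
      using u by (simp add: L2_inner_self_class less_quat_def)
  next
    fix U V :: "('w \<Rightarrow> quat) set" and q assume "U \<in> carrier (L2 M)" "V \<in> carrier (L2 M)"
    then obtain u v where [simp]: "U = L2_class M u" "V = L2_class M v"
      and uv: "u \<in> L2_fun M" "v \<in> L2_fun M" by (auto elim!: L2_class_cases)
    show "qscale (L2 M) (U \<oplus>\<^bsub>L2 M\<^esub> V) q = qscale (L2 M) U q \<oplus>\<^bsub>L2 M\<^esub> qscale (L2 M) V q"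
      using uv by (simp add: L2_scale_class L2_add_class L2_fun_mult L2_fun_add distrib_right)
    show "qinner (L2 M) U V = qcnj (qinner (L2 M) V U)"
      using uv integral_bounded_linear[OF bounded_linear_qcnj integrable_inner[of v M u]]
      by (simp add: L2_inner_class)
    show "qinner (L2 M) U (qscale (L2 M) V q) = qinner (L2 M) U V * q"
      using uv integrable_inner[OF uv]
      by (simp add: L2_inner_class L2_scale_class L2_fun_mult mult.assoc[symmetric])
  next
    fix U V W :: "('w \<Rightarrow> quat) set"
    assume "U \<in> carrier (L2 M)" "V \<in> carrier (L2 M)" "W \<in> carrier (L2 M)"
    then obtain u v w where [simp]: "U = L2_class M u" "V = L2_class M v" "W = L2_class M w"
      and uv: "u \<in> L2_fun M" "v \<in> L2_fun M" "w \<in> L2_fun M" by (auto elim!: L2_class_cases)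
    show "qinner (L2 M) U (V \<oplus>\<^bsub>L2 M\<^esub> W) = qinner (L2 M) U V + qinner (L2 M) U W"
      using uv by (simp add: L2_inner_class L2_add_class L2_fun_add distrib_left integrable_inner)
  next
    fix s :: "nat \<Rightarrow> ('w \<Rightarrow> quat) set"
    assume s: "\<And>n. s n \<in> carrier (L2 M)"
      and Cauchy: "\<And>e. 0 < e \<Longrightarrow> \<exists>N. \<forall>m\<ge>N. \<forall>n\<ge>N. qnorm (L2 M) (s m \<ominus>\<^bsub>L2 M\<^esub> s n) < e"
    have "\<forall>n. \<exists>f. f \<in> L2_fun M \<and> s n = L2_class M f" using s by (metis L2_class_cases)
    then obtain f where f: "\<And>n. f n \<in> L2_fun M" and sf: "\<And>n. s n = L2_class M (f n)" by metis
    have dist: "(\<integral>\<^sup>+ w. ennreal ((norm (g w - h w))\<^sup>2) \<partial>M)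
        = ennreal ((qnorm (L2 M) (L2_class M g \<ominus>\<^bsub>L2 M\<^esub> L2_class M h))\<^sup>2)"
      if "g \<in> L2_fun M" "h \<in> L2_fun M" for g h
      using that by (simp add: nn_integral_L2_class[OF L2_fun_diff] L2_diff_class)
    have nonneg: "0 \<le> qnorm (L2 M) (L2_class M g)" if "g \<in> L2_fun M" for g
      using that by (simp add: qnorm_def L2_inner_self_class)
    have "\<exists>l\<in>L2_fun M. (\<lambda>n. \<integral>\<^sup>+ w. ennreal ((norm (f n w - l w))\<^sup>2) \<partial>M) \<longlonglongrightarrow> 0"
    proof (rule L2_Cauchy_limit[OF f])
      fix e :: real assume "0 < e"
      then obtain N where N: "\<And>m n. \<lbrakk>m \<ge> N; n \<ge> N\<rbrakk> \<Longrightarrow> qnorm (L2 M) (s m \<ominus>\<^bsub>L2 M\<^esub> s n) < sqrt e"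
        using Cauchy[of "sqrt e"] by auto
      show "\<exists>N. \<forall>m\<ge>N. \<forall>n\<ge>N. (\<integral>\<^sup>+ w. ennreal ((norm (f m w - f n w))\<^sup>2) \<partial>M) \<le> ennreal e"
      proof (intro exI allI impI)
        fix m n assume mn: "m \<ge> N" "n \<ge> N"
        have "(qnorm (L2 M) (s m \<ominus>\<^bsub>L2 M\<^esub> s n))\<^sup>2 \<le> (sqrt e)\<^sup>2"
          using N[OF mn] f nonneg[OF L2_fun_diff[OF f f, of m n]]
          by (intro power_mono) (simp_all add: sf L2_diff_class)
        then show "(\<integral>\<^sup>+ w. ennreal ((norm (f m w - f n w))\<^sup>2) \<partial>M) \<le> ennreal e"
          using f \<open>0 < e\<close> by (simp add: dist sf ennreal_leI)
      qed
    qed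
    then obtain l where l: "l \<in> L2_fun M"
      and lim: "(\<lambda>n. \<integral>\<^sup>+ w. ennreal ((norm (f n w - l w))\<^sup>2) \<partial>M) \<longlonglongrightarrow> 0" by blast
    have "(\<lambda>n. (qnorm (L2 M) (s n \<ominus>\<^bsub>L2 M\<^esub> L2_class M l))\<^sup>2) \<longlonglongrightarrow> 0"
      using lim f l by (simp add: dist sf tendsto_ennreal_iff[where x = 0, simplified])
    then have "(\<lambda>n. sqrt ((qnorm (L2 M) (s n \<ominus>\<^bsub>L2 M\<^esub> L2_class M l))\<^sup>2)) \<longlonglongrightarrow> sqrt 0"
      by (rule tendsto_real_sqrt)
    then have "(\<lambda>n. qnorm (L2 M) (s n \<ominus>\<^bsub>L2 M\<^esub> L2_class M l)) \<longlonglongrightarrow> 0"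
      using f l nonneg[OF L2_fun_diff[OF f l]] by (simp add: sf L2_diff_class)
    then show "\<exists>l\<in>carrier (L2 M). (\<lambda>n. qnorm (L2 M) (s n \<ominus>\<^bsub>L2 M\<^esub> l)) \<longlonglongrightarrow> 0"
      using l by (intro bexI[of _ "L2_class M l"]) auto
  qed
qed

section \<open>Continuous K-frames\<close>

text \<open>
  The Bessel bound is exactly boundedness of the transform operator. Since
  \<open>F\<close> is only known to take values in \<open>H\<close> on \<open>space M\<close>, linearity in \<open>u\<close> is shown for the classes
  rather than for the functions themselves.
\<close>

lemma transform_op_bounded:
  fixes M :: "'w measure"
  assumes H: "right_quat_hilbert_space H" and F: "bessel_mapping M H F"
  shows "transform_op M H F \<in> bounded_ops H (L2 M)"
    and "\<And>u. u \<in> carrier H \<Longrightarrow>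
      (\<integral>\<^sup>+ w. ennreal ((norm (qinner H (F w) u))\<^sup>2) \<partial>M) = ennreal ((qnorm (L2 M) (transform_op M H F u))\<^sup>2)"
proof -
  interpret H: right_quat_hilbert_space H by (rule H)
  interpret G: right_quat_hilbert_space "L2 M" by (rule L2_right_quat_hilbert_space)
  define f where "f u = (\<lambda>w. qinner H (F w) u)" for u
  obtain B where "0 < B" and B: "\<And>u. u \<in> carrier H \<Longrightarrow>
      (\<integral>\<^sup>+ w. ennreal ((norm (f u w))\<^sup>2) \<partial>M) \<le> ennreal (B * (qnorm H u)\<^sup>2)"
    using F by (auto simp: bessel_mapping_def f_def)
  have F_closed: "F w \<in> carrier H" if "w \<in> space M" for w
    using F that by (auto simp: bessel_mapping_def weakly_measurable_def)
  have f: "f u \<in> L2_fun M" if "u \<in> carrier H" for u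
    using F that le_less_trans[OF B[OF that]]
    by (auto simp: L2_fun_iff_nn_integral bessel_mapping_def weakly_measurable_def f_def)
  have T: "transform_op M H F u = L2_class M (f u)" if "u \<in> carrier H" for u
    using that by (simp add: transform_op_def f_def)
  show norm: "(\<integral>\<^sup>+ w. ennreal ((norm (qinner H (F w) u))\<^sup>2) \<partial>M) = ennreal ((qnorm (L2 M) (transform_op M H F u))\<^sup>2)"
    if "u \<in> carrier H" for u
    using nn_integral_L2_class[OF f[OF that]] that by (simp add: T f_def)
  have "transform_op M H F (u \<oplus>\<^bsub>H\<^esub> v) = transform_op M H F u \<oplus>\<^bsub>L2 M\<^esub> transform_op M H F v"
    if u: "u \<in> carrier H" and v: "v \<in> carrier H" for u v
  proof -
    have "AE w in M. f (u \<oplus>\<^bsub>H\<^esub> v) w = f u w + f v w"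
      using u v by (intro AE_I2) (simp add: f_def F_closed H.inner_add)
    then show ?thesis using u v by (simp add: T L2_add_class L2_class_eq_iff f L2_fun_add)
  qed
  moreover have "transform_op M H F (qscale H u q) = qscale (L2 M) (transform_op M H F u) q"
    if u: "u \<in> carrier H" for u q
  proof -
    have "AE w in M. f (qscale H u q) w = f u w * q"
      using u by (intro AE_I2) (simp add: f_def F_closed H.inner_scale)
    then show ?thesis using u by (simp add: T L2_scale_class L2_class_eq_iff f L2_fun_mult H.scale_closed)
  qed
  moreover have "qnorm (L2 M) (transform_op M H F u) \<le> sqrt B * qnorm H u" if u: "u \<in> carrier H" for u
  proof (rule power2_le_imp_le)
    show "(qnorm (L2 M) (transform_op M H F u))\<^sup>2 \<le> (sqrt B * qnorm H u)\<^sup>2"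
      using B[OF u] norm[OF u] \<open>0 < B\<close> by (simp add: f_def power_mult_distrib)
    show "0 \<le> sqrt B * qnorm H u" using u \<open>0 < B\<close> by simp
  qed
  moreover have "transform_op M H F \<in> carrier H \<rightarrow>\<^sub>E carrier (L2 M)"
    using f by (auto simp: transform_op_def f_def)
  ultimately show "transform_op M H F \<in> bounded_ops H (L2 M)"
    by (auto simp: bounded_ops_def intro!: exI[of _ "sqrt B"])
qed

theorem theorem7:
  fixes M :: "'w measure" and H :: "'a quat_space"
    and F :: "'w \<Rightarrow> 'a" and K :: "'a \<Rightarrow> 'a"
  assumes "right_quat_hilbert_space H"
    and "bessel_mapping M H F"
    and "K \<in> bounded_ops H H"
  shows "(continuous_K_frame M H K F
          \<longleftrightarrow> K ` carrier H \<subseteq> pre_frame_op M H F ` carrier (L2 M))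
       \<and> (K ` carrier H \<subseteq> pre_frame_op M H F ` carrier (L2 M)
          \<longleftrightarrow> (\<exists>c::real. 0 < c \<and>
                op_le H (op_scale H (op_comp H K (op_adjoint H H K)) c) (frame_op M H F)))
       \<and> ((\<exists>c::real. 0 < c \<and>
                op_le H (op_scale H (op_comp H K (op_adjoint H H K)) c) (frame_op M H F))
          \<longleftrightarrow> (\<exists>X \<in> bounded_ops H (L2 M). K = op_comp H (pre_frame_op M H F) X))"
proof -
  interpret H: right_quat_hilbert_space H by (rule assms(1))
  interpret G: right_quat_hilbert_space "L2 M" by (rule L2_right_quat_hilbert_space)
  define \<theta> where "\<theta> = transform_op M H F"
  interpret common_codomain H H "L2 M" K \<theta>
    by unfold_locales (use assms transform_op_bounded(1) in \<open>auto simp: \<theta>_def\<close>)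
  have pre: "pre_frame_op M H F = op_adjoint H (L2 M) \<theta>"
    by (simp add: pre_frame_op_def \<theta>_def)
  note energy = transform_op_bounded(2)[OF assms(1,2), folded \<theta>_def]
  obtain B where B: "0 < B" "\<And>u. u \<in> carrier H \<Longrightarrow>
      (\<integral>\<^sup>+ w. ennreal ((norm (qinner H (F w) u))\<^sup>2) \<partial>M) \<le> ennreal (B * (qnorm H u)\<^sup>2)"
    using assms(2) by (auto simp: bessel_mapping_def)
  let ?majorized = "\<exists>c>0. \<forall>u\<in>carrier H. c * (qnorm H (K_adj u))\<^sup>2 \<le> (qnorm (L2 M) (\<theta> u))\<^sup>2"
  have "continuous_K_frame M H K F \<longleftrightarrow> ?majorized"
  proof
    assume "continuous_K_frame M H K F"
    then show ?majorized by (auto simp: continuous_K_frame_def energy)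
  next
    assume ?majorized
    then obtain c where c: "c > 0" "\<And>u. u \<in> carrier H \<Longrightarrow>
        c * (qnorm H (K_adj u))\<^sup>2 \<le> (qnorm (L2 M) (\<theta> u))\<^sup>2" by blast
    \<comment> \<open>The lower frame bound must not exceed the Bessel bound \<open>B\<close>, whereas \<open>c\<close> may.\<close>
    have "min c B * (qnorm H (K_adj u))\<^sup>2 \<le> (qnorm (L2 M) (\<theta> u))\<^sup>2" if "u \<in> carrier H" for u
      using c(2)[OF that] mult_right_mono[of "min c B" c "(qnorm H (K_adj u))\<^sup>2"] by simp
    with c(1) B show "continuous_K_frame M H K F"
      using assms(2) unfolding continuous_K_frame_def bessel_mapping_def
      by (intro conjI exI[of _ "min c B"] exI[of _ B]) (auto simp: energy ennreal_leI)
  qed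
  moreover have "op_le H (op_scale H (op_comp H K K_adj) c) (frame_op M H F) \<longleftrightarrow>
      (\<forall>u\<in>carrier H. c * (qnorm H (K_adj u))\<^sup>2 \<le> (qnorm (L2 M) (\<theta> u))\<^sup>2)" for c
  proof -
    have "qinner H (op_scale H (op_comp H K K_adj) c u) u = of_real (c * (qnorm H (K_adj u))\<^sup>2)"
      if u: "u \<in> carrier H" for u
      using u K.inner_adjoint[of "K_adj u" u]
      by (simp add: op_scale_def op_comp_def compose_eq H.inner_scale_left H.inner_self)
    moreover have "qinner H (frame_op M H F u) u = of_real ((qnorm (L2 M) (\<theta> u))\<^sup>2)"
      if u: "u \<in> carrier H" for u
      using u by (simp add: frame_op_def pre op_comp_def compose_eq L.inner_adjoint_left
          G.inner_self flip: \<theta>_def)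
    ultimately show ?thesis
      by (simp add: op_le_def less_eq_quat_def del: of_real_mult of_real_power)
  qed
  ultimately show ?thesis
    using Douglas_factorization by (simp add: pre)
qed

end
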